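(* Fix $p\ge3$ and let $(\beta,h)\in\Theta$ be $p$-special, with $\beta$ known and $\bm X\sim\mathbb P_{\beta,h,p}$. Let $m_*$ be the unique global maximizer of $H=H_{\beta,h,p}$. For $a,b\in\mathbb R$ let $F_{a,b}$ be the probability distribution (and its distribution function) with Lebesgue density proportional to $\exp\big(\frac{H^{(4)}(m_* )}{24}x^4+(apm_*^{p-1}+b)x\big)$. Then as $N\to\infty$, $N^{3/4}(\hat h_N-h)\to G_1$ in distribution, where $G_1(t)=F_{0,0}\big(\int_{-\infty}^\infty u\,\mathrm dF_{0,t}(u)\big)$.
   Context: The $p$-tensor Curie–Weiss model on $\{-1,1\}^N$: $\mathbb P_{\beta,h,p}(\bm X)=\frac{1}{2^NZ_N(\beta,h,p)}\exp\{N(\beta\bar X_N^p+h\bar X_N)\}$ with $\bar X_N=N^{-1}\sum_iX_i$, $(\beta,h)\in\mathbb R^2$; $\Theta=[0,\infty)\times\mathbb R$. $I(x)=\frac12[(1+x)\log(1+x)+(1-x)\log(1-x)]$, $H_{\beta,h,p}(x)=\beta x^p+hx-I(x)$ on $[-1,1]$. $(\beta,h)$ is $p$-special if $H_{\beta,h,p}$ has a unique global maximizer $m_*\in(-1,1)$ and $H''(m_* )=0$. For known $\beta$, $\hat h_N$ is the maximum likelihood estimate of $h$, i.e. the solution in $h$ of $\mathbb E_{\beta,h,p}(\bar X_N)=\bar X_N$. *)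

theory Defs
  imports "HOL-Analysis.Analysis"
begin

definition I_fun :: "real \<Rightarrow> real" where
  "I_fun x = ((1 + x) * ln (1 + x) + (1 - x) * ln (1 - x)) / 2"

definition H_fun :: "real \<Rightarrow> real \<Rightarrow> nat \<Rightarrow> real \<Rightarrow> real" where
  "H_fun \<beta> h p x = \<beta> * x ^ p + h * x - I_fun x"

definition p_special :: "real \<Rightarrow> real \<Rightarrow> nat \<Rightarrow> bool" where
  "p_special \<beta> h p \<longleftrightarrow>
     (\<exists>m. m \<in> {-1<..<1} \<and> (\<forall>x\<in>{-1..1}. x \<noteq> m \<longrightarrow> H_fun \<beta> h p x < H_fun \<beta> h p m)
          \<and> deriv (deriv (H_fun \<beta> h p)) m = 0)"

definition configs :: "nat \<Rightarrow> (nat \<Rightarrow> real) set" where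
  "configs N = {..<N} \<rightarrow>\<^sub>E {-1, 1}"

definition xbar :: "nat \<Rightarrow> (nat \<Rightarrow> real) \<Rightarrow> real" where
  "xbar N x = (\<Sum>i<N. x i) / real N"

definition cw_weight :: "real \<Rightarrow> real \<Rightarrow> nat \<Rightarrow> nat \<Rightarrow> (nat \<Rightarrow> real) \<Rightarrow> real" where
  "cw_weight \<beta> h p N x = exp (real N * (\<beta> * xbar N x ^ p + h * xbar N x)) / 2 ^ N"

definition cw_Z :: "real \<Rightarrow> real \<Rightarrow> nat \<Rightarrow> nat \<Rightarrow> real" where
  "cw_Z \<beta> h p N = (\<Sum>x\<in>configs N. cw_weight \<beta> h p N x)"

definition cw_prob :: "real \<Rightarrow> real \<Rightarrow> nat \<Rightarrow> nat \<Rightarrow> (nat \<Rightarrow> real) set \<Rightarrow> real" where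
  "cw_prob \<beta> h p N A = (\<Sum>x\<in>configs N \<inter> A. cw_weight \<beta> h p N x) / cw_Z \<beta> h p N"

definition cw_mean :: "real \<Rightarrow> real \<Rightarrow> nat \<Rightarrow> nat \<Rightarrow> real" where
  "cw_mean \<beta> h p N = (\<Sum>x\<in>configs N. xbar N x * cw_weight \<beta> h p N x) / cw_Z \<beta> h p N"

definition mle_h :: "real \<Rightarrow> nat \<Rightarrow> nat \<Rightarrow> real \<Rightarrow> real" where
  "mle_h \<beta> p N xb = (THE h. cw_mean \<beta> h p N = xb)"

text \<open>Unnormalised density of F_{a,b}: exp(c/24 x^4 + (a p m^(p-1) + b) x), with c = H''''(m).\<close>
definition F_dens :: "real \<Rightarrow> nat \<Rightarrow> real \<Rightarrow> real \<Rightarrow> real \<Rightarrow> real \<Rightarrow> real" where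
  "F_dens c p m a b x = exp (c / 24 * x ^ 4 + (a * real p * m ^ (p - 1) + b) * x)"

definition F_cdf :: "real \<Rightarrow> nat \<Rightarrow> real \<Rightarrow> real \<Rightarrow> real \<Rightarrow> real \<Rightarrow> real" where
  "F_cdf c p m a b t = (LINT x:{..t}|lborel. F_dens c p m a b x) / (LINT x|lborel. F_dens c p m a b x)"

definition F_mean :: "real \<Rightarrow> nat \<Rightarrow> real \<Rightarrow> real \<Rightarrow> real \<Rightarrow> real" where
  "F_mean c p m a b = (LINT x|lborel. x * F_dens c p m a b x) / (LINT x|lborel. F_dens c p m a b x)"

end

theory Submission
  imports Defs "HOL-Probability.Sinc_Integral" "HOL-Real_Asymp.Real_Asymp"
begin

text \<open>Since the mean magnetization is strictly increasing in the field, the event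
  \<open>N\<^sup>3\<^sup>/\<^sup>4 (mle - h) \<le> t\<close> says that \<open>xbar\<close> is at most its mean under the field
  \<open>h + t N\<^sup>-\<^sup>3\<^sup>/\<^sup>4\<close>. At a special point the maximality of \<open>H\<close> forces \<open>H'''(m) = 0\<close>, whence
  \<open>m\<^sup>2 = (p - 2) / p\<close> and \<open>H''''(m) = - p\<^sup>3 / 2 < 0\<close>, so \<open>H(x) - H(m)\<close> is \<open>(x - m)\<^sup>4\<close> times a
  function that is negative, bounded away from 0 and continuous at \<open>m\<close>. Fluctuations of \<open>xbar\<close>
  therefore live on the scale \<open>N\<^sup>-\<^sup>1\<^sup>/\<^sup>4\<close>: by Stirling's formula and dominated convergence,
  \<open>N\<^sup>1\<^sup>/\<^sup>4 (xbar - m)\<close> converges in law to \<open>F\<^sub>0\<^sub>,\<^sub>0\<close> under the field \<open>h\<close>, and its mean under the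
  field \<open>h + t N\<^sup>-\<^sup>3\<^sup>/\<^sup>4\<close> converges to the mean of \<open>F\<^sub>0\<^sub>,\<^sub>t\<close>. The unknown constant in
  Stirling's formula cancels in these quotients.\<close>

subsection \<open>Stirling's formula up to a constant\<close>

text \<open>For \<open>n \<ge> 1\<close> this is n! divided by its Stirling approximation without
  the constant sqrt(2 pi). The \<open>max\<close> gives the value 1 at \<open>n = 0\<close> instead
  of a division by zero, so the ratio is positive everywhere and the levels \<open>k = 0\<close> and
  \<open>k = N\<close> need no special treatment.\<close>

definition stirling_ratio :: "nat \<Rightarrow> real" where
  "stirling_ratio n = fact n * exp (real n) / (real n ^ n * sqrt (max 1 (real n)))"

lemma stirling_ratio_pos: "stirling_ratio n > 0"
  by (cases "n = 0") (auto simp: stirling_ratio_def intro!: divide_pos_pos mult_pos_pos)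

lemma ln_stirling_ratio:
  assumes "n \<ge> 1"
  shows "ln (stirling_ratio n) = ln (fact n) + real n - real n * ln (real n) - ln (real n) / 2"
  using assms by (simp add: stirling_ratio_def ln_div ln_mult ln_realpow ln_sqrt max_def)

lemma ln_stirling_ratio_Suc:
  assumes "n \<ge> 1"
  shows "ln (stirling_ratio (Suc n)) - ln (stirling_ratio n)
           = 1 - (real n + 1/2) * (ln (real n + 1) - ln (real n))"
proof -
  have "ln (fact (Suc n) :: real) = ln (real n + 1) + ln (fact n)"
    by (simp add: ln_mult add.commute)
  then show ?thesis
    using assms by (simp add: ln_stirling_ratio algebra_simps add_divide_distrib)
qed

text \<open>The increments of the logarithm are O(1/n^2), hence summable, and the partial sums
  telescope. The limit is positive because it is an exponential.\<close>

lemma stirling_ratio_tendsto: "\<exists>L>0. stirling_ratio \<longlonglongrightarrow> L"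
proof -
  let ?g = "\<lambda>n. ln (stirling_ratio n)"
  have "(\<lambda>n. 1 - (real n + 1/2) * (ln (real n + 1) - ln (real n))) \<in> O(\<lambda>n. 1 / real n ^ 2)"
    by real_asymp
  then have "(\<lambda>n. ?g (Suc n) - ?g n) \<in> O(\<lambda>n. 1 / real n ^ 2)"
    by (rule landau_o.big.in_cong[THEN iffD1, rotated])
       (auto intro!: eventually_mono[OF eventually_ge_at_top[of 1]] simp: ln_stirling_ratio_Suc)
  then have "summable (\<lambda>n. ?g (Suc n) - ?g n)"
    by (rule summable_comparison_test_bigo[rotated])
       (use inverse_power_summable[of 2, where ?'a = real] in \<open>simp add: divide_inverse\<close>)
  then have "(\<lambda>n. ?g n - ?g 0) \<longlonglongrightarrow> (\<Sum>n. ?g (Suc n) - ?g n)"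
    by (drule_tac summable_LIMSEQ) (simp only: sum_lessThan_telescope[of ?g])
  then have "(\<lambda>n. ?g n - ?g 0 + ?g 0) \<longlonglongrightarrow> (\<Sum>n. ?g (Suc n) - ?g n) + ?g 0"
    by (intro tendsto_add) auto
  then have "(\<lambda>n. exp (?g n)) \<longlonglongrightarrow> exp ((\<Sum>n. ?g (Suc n) - ?g n) + ?g 0)"
    by (intro tendsto_exp) simp
  then show ?thesis
    using stirling_ratio_pos by (intro exI[of _ "exp ((\<Sum>n. ?g (Suc n) - ?g n) + ?g 0)"]) simp
qed

section \<open>Binomial coefficients compared with the entropy at the lattice of
  magnetizations\<close>

definition node :: "nat \<Rightarrow> nat \<Rightarrow> real" where
  "node N k = 2 * real k / real N - 1"

lemma node_bounds:
  assumes "k \<le> N" "N \<ge> 1"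
  shows "node N k \<in> {-1..1}"
  using assms by (auto simp: node_def field_simps)

text \<open>The subexponential part of the binomial law: the probability of \<open>k\<close>
  positive spins among \<open>N\<close> fair ones decays like exp(-N I), and
  \<open>sqrt (real N)\<close> makes what remains converge in the interior.\<close>

definition entropy_factor :: "nat \<Rightarrow> nat \<Rightarrow> real" where
  "entropy_factor N k = sqrt (real N) * real (N choose k) / 2 ^ N * exp (real N * I_fun (node N k))"

lemma exp_I_fun_node:
  assumes "k \<le> N" "N \<ge> 1"
  shows "exp (real N * I_fun (node N k))
           = 2 ^ N * real k ^ k * real (N - k) ^ (N - k) / real N ^ N"
proof -
  have *: "real j * ln (2 * real j / real N) = real j * ln 2 + real j * ln (real j) - real j * ln (real N)" for j
    using assms by (cases "j = 0") (auto simp: ln_div ln_mult algebra_simps)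
  \<comment> \<open>At \<open>j = 0\<close> the convention \<open>0 ^ 0 = 1\<close> matches
    \<open>0 * ln 0 = 0\<close>, so the endpoints -1 and 1 are covered.\<close>
  have **: "exp (real j * ln (real j)) = real j ^ j" for j :: nat
    by (cases "j = 0") (auto simp: exp_of_nat_mult)
  have k1: "1 + node N k = 2 * real k / real N" "1 - node N k = 2 * real (N - k) / real N"
    using assms by (auto simp: node_def field_simps of_nat_diff)
  have "real N * I_fun (node N k) = real k * ln (2 * real k / real N)
          + real (N - k) * ln (2 * real (N - k) / real N)"
    unfolding I_fun_def k1 using assms by (simp add: field_simps)
  also have "\<dots> = real N * ln 2 + real k * ln (real k) + real (N - k) * ln (real (N - k))
                 - real N * ln (real N)"
    unfolding * using assms by (simp add: of_nat_diff algebra_simps)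
  finally show ?thesis
    by (simp only: exp_add exp_diff **) (simp add: exp_of_nat_mult)
qed

text \<open>Substituting Stirling ratios for the factorials cancels all powers and exponentials,
  because k + (N - k) = N. Only the square roots survive.\<close>

lemma entropy_factor_eq:
  assumes "k \<le> N" "N \<ge> 1"
  shows "entropy_factor N k = stirling_ratio N / (stirling_ratio k * stirling_ratio (N - k))
           * (real N / (sqrt (max 1 (real k)) * sqrt (max 1 (real (N - k)))))"
proof -
  have c: "real (N choose k) = fact N / (fact k * fact (N - k))"
    using assms by (simp add: binomial_fact)
  have e: "exp (real N) = exp (real k) * exp (real (N - k))"
    using assms by (simp flip: exp_add)
  have s: "sqrt (real N) * sqrt (real N) = real N" by simp
  have "real j ^ j > 0" for j :: nat by (cases "j = 0") auto
  note pos = this[of k] this[of "N - k"] this[of N]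
  have sq: "sqrt (max 1 (real j)) > 0" for j by auto
  have mN: "max 1 (real N) = real N" using assms by auto
  have "entropy_factor N k = sqrt (real N) * fact N * real k ^ k * real (N - k) ^ (N - k)
           / (fact k * fact (N - k) * real N ^ N)"
    unfolding entropy_factor_def exp_I_fun_node[OF assms] c by simp
  \<comment> \<open>The fraction is expanded by \<open>sqrt (real N)\<close>, the root that
    \<open>stirling_ratio N\<close> carries in its denominator.\<close>
  also have "\<dots> = (sqrt (real N) * sqrt (real N)) * fact N * real k ^ k * real (N - k) ^ (N - k)
           / (fact k * fact (N - k) * real N ^ N * sqrt (real N))"
    using assms by (simp only: mult.assoc) (simp add: field_simps)
  also have "\<dots> = stirling_ratio N / (stirling_ratio k * stirling_ratio (N - k))
           * (real N / (sqrt (max 1 (real k)) * sqrt (max 1 (real (N - k)))))"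
    unfolding stirling_ratio_def s e mN using pos sq[of k] sq[of "N-k"] assms
    by (simp add: field_simps)
  finally show ?thesis .
qed

text \<open>Near the endpoints \<open>k\<close> or \<open>N - k\<close> stays small and its Stirling
  ratio need not be close to the limit. Boundedness of the ratios and of their inverses still gives
  an estimate uniform in \<open>k\<close>.\<close>

lemma entropy_factor_bound:
  "\<exists>C>0. \<forall>N k. 1 \<le> N \<longrightarrow> k \<le> N \<longrightarrow>
     entropy_factor N k \<le> C * (real N / (sqrt (max 1 (real k)) * sqrt (max 1 (real (N - k)))))"
proof -
  obtain L where L: "L > 0" "stirling_ratio \<longlonglongrightarrow> L" using stirling_ratio_tendsto by blast
  have "Bseq stirling_ratio" using L(2) convergentI convergent_imp_Bseq by blast
  then obtain U where U: "U > 0" "\<And>n. stirling_ratio n \<le> U"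
    unfolding Bseq_def by (metis abs_le_D1 real_norm_def)
  have "(\<lambda>n. inverse (stirling_ratio n)) \<longlonglongrightarrow> inverse L" using L by (intro tendsto_intros) auto
  then have "Bseq (\<lambda>n. inverse (stirling_ratio n))" using convergentI convergent_imp_Bseq by blast
  then obtain V where V: "V > 0" "\<And>n. inverse (stirling_ratio n) \<le> V"
    unfolding Bseq_def by (metis abs_le_D1 real_norm_def)
  show ?thesis
  proof (intro exI[of _ "U * V * V"] conjI allI impI)
    show "U * V * V > 0" using U V by simp
    fix N k :: nat assume "1 \<le> N" "k \<le> N"
    have "stirling_ratio N / (stirling_ratio k * stirling_ratio (N - k))
        = stirling_ratio N * inverse (stirling_ratio k) * inverse (stirling_ratio (N - k))"
      by (simp add: field_simps)
    also have "\<dots> \<le> U * V * V"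
      using U V stirling_ratio_pos by (intro mult_mono) (auto intro: less_imp_le)
    finally show "entropy_factor N k \<le> U * V * V *
        (real N / (sqrt (max 1 (real k)) * sqrt (max 1 (real (N - k)))))"
      unfolding entropy_factor_eq[OF \<open>k \<le> N\<close> \<open>1 \<le> N\<close>] by (intro mult_right_mono) auto
  qed
qed

text \<open>At an interior limit point both \<open>k N\<close> and \<open>N - k N\<close> tend to
  infinity, so all three Stirling ratios tend to \<open>L\<close>, leaving one factor 1/L and the
  limit of N / sqrt(k (N - k)).\<close>

lemma entropy_factor_tendsto:
  assumes L: "stirling_ratio \<longlonglongrightarrow> L" "L > 0"
    and x: "(\<lambda>N. node N (k N)) \<longlonglongrightarrow> x" "x \<in> {-1<..<1}"
    and k: "eventually (\<lambda>N. k N \<le> N) sequentially"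
  shows "(\<lambda>N. entropy_factor N (k N)) \<longlonglongrightarrow> 2 / (L * sqrt (1 - x\<^sup>2))"
proof -
  have N: "filterlim real at_top sequentially" by (rule filterlim_real_sequentially)
  have k1: "filterlim (\<lambda>N. (1 + node N (k N)) / 2 * real N) at_top sequentially"
    by (rule filterlim_tendsto_pos_mult_at_top[OF _ _ N, of _ "(1 + x) / 2"])
       (use x in \<open>auto intro!: tendsto_intros\<close>)
  have k2: "filterlim (\<lambda>N. (1 - node N (k N)) / 2 * real N) at_top sequentially"
    by (rule filterlim_tendsto_pos_mult_at_top[OF _ _ N, of _ "(1 - x) / 2"])
       (use x in \<open>auto intro!: tendsto_intros\<close>)
  have e1: "eventually (\<lambda>N. (1 + node N (k N)) / 2 * real N = real (k N)) sequentially"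
    using eventually_gt_at_top[of 0] by eventually_elim (auto simp: node_def)
  have e2: "eventually (\<lambda>N. (1 - node N (k N)) / 2 * real N = real (N - k N)) sequentially"
    using eventually_gt_at_top[of 0] k
    by eventually_elim (auto simp: node_def of_nat_diff field_simps)
  have K1: "filterlim (\<lambda>N. real (k N)) at_top sequentially"
    using k1 by (rule filterlim_cong[THEN iffD1, rotated 3]) (use e1 in auto)
  have K2: "filterlim (\<lambda>N. real (N - k N)) at_top sequentially"
    using k2 by (rule filterlim_cong[THEN iffD1, rotated 3]) (use e2 in auto)
  have K1': "filterlim k at_top sequentially" using K1
    by (simp add: filterlim_sequentially_iff_filterlim_real)
  have K2': "filterlim (\<lambda>N. N - k N) at_top sequentially" using K2
    by (simp add: filterlim_sequentially_iff_filterlim_real)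
  have "(\<lambda>N. stirling_ratio N / (stirling_ratio (k N) * stirling_ratio (N - k N))
          * (1 / (sqrt ((1 + node N (k N)) / 2) * sqrt ((1 - node N (k N)) / 2))))
        \<longlonglongrightarrow> L / (L * L) * (1 / (sqrt ((1 + x) / 2) * sqrt ((1 - x) / 2)))"
    using L x by (intro tendsto_intros filterlim_compose[OF L(1) K1'] filterlim_compose[OF L(1) K2']) auto
  also have "L / (L * L) * (1 / (sqrt ((1 + x) / 2) * sqrt ((1 - x) / 2))) = 2 / (L * sqrt (1 - x\<^sup>2))"
  proof -
    have "sqrt ((1 + x) / 2) * sqrt ((1 - x) / 2) = sqrt ((1 - x\<^sup>2) / 2\<^sup>2)"
      by (simp add: real_sqrt_mult[symmetric] power2_eq_square algebra_simps)
    then show ?thesis using L by (simp add: real_sqrt_divide)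
  qed
  finally show ?thesis
  proof (rule Lim_transform_eventually)
    show "\<forall>\<^sub>F N in sequentially. stirling_ratio N / (stirling_ratio (k N) * stirling_ratio (N - k N))
          * (1 / (sqrt ((1 + node N (k N)) / 2) * sqrt ((1 - node N (k N)) / 2)))
          = entropy_factor N (k N)"
      using e1 e2 k eventually_gt_at_top[of 0] K1[unfolded filterlim_at_top, rule_format, of 1]
        K2[unfolded filterlim_at_top, rule_format, of 1]
    proof eventually_elim
      case (elim N)
      have "sqrt (real (k N)) * sqrt (real (N - k N))
          = sqrt ((1 + node N (k N)) / 2) * sqrt ((1 - node N (k N)) / 2) * (sqrt (real N) * sqrt (real N))"
        unfolding elim(1)[symmetric] elim(2)[symmetric] by (simp only: real_sqrt_mult mult_ac)
      then have "sqrt (real (k N)) * sqrt (real (N - k N))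
          = sqrt ((1 + node N (k N)) / 2) * sqrt ((1 - node N (k N)) / 2) * real N"
        by simp
      moreover have "max 1 (real (k N)) = real (k N)" "max 1 (real (N - k N)) = real (N - k N)"
        using elim by auto
      ultimately show ?case
        using elim by (simp add: entropy_factor_eq)
    qed
  qed
qed

subsection \<open>Reduction to sums over the number of positive spins\<close>

lemma finite_configs [simp]: "finite (configs N)"
  by (simp add: configs_def finite_PiE)

text \<open>A configuration is determined by its set of positive spins, and its magnetization
  depends only on the size of that set.\<close>

lemma sum_configs:
  assumes "N \<ge> 1"
  shows "(\<Sum>x\<in>configs N. g (xbar N x)) = (\<Sum>k\<le>N. real (N choose k) * g (node N k))"
proof -
  define F :: "nat set \<Rightarrow> nat \<Rightarrow> real"
    where "F S = (\<lambda>i. if i \<in> {..<N} then (if i \<in> S then 1 else -1) else undefined)" for S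
  have bij: "bij_betw F (Pow {..<N}) (configs N)"
  proof (rule bij_betw_byWitness[where f' = "\<lambda>x. {i\<in>{..<N}. x i = 1}"])
    show "\<forall>x\<in>configs N. F {i \<in> {..<N}. x i = 1} = x"
      by (auto simp: F_def configs_def PiE_def extensional_def Pi_def fun_eq_iff)
  qed (auto simp: F_def configs_def PiE_def extensional_def Pi_def)
  have xb: "xbar N (F S) = node N (card S)" if "S \<subseteq> {..<N}" for S
  proof -
    have "(\<Sum>i<N. F S i) = (\<Sum>i<N. 2 * (if i \<in> S then 1 else 0) - 1)"
      by (rule sum.cong) (auto simp: F_def)
    also have "\<dots> = 2 * real (card S) - real N"
      using that by (simp add: sum_subtractf sum_distrib_left[symmetric] sum.If_cases Int_absorb1)
    finally show ?thesis using assms by (simp add: xbar_def node_def diff_divide_distrib)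
  qed
  have "(\<Sum>x\<in>configs N. g (xbar N x)) = (\<Sum>S\<in>Pow {..<N}. g (node N (card S)))"
    using sum.reindex_bij_betw[OF bij, of "\<lambda>x. g (xbar N x)"] xb by (auto intro: sum.cong)
  also have "\<dots> = (\<Sum>k\<le>N. \<Sum>S\<in>{S\<in>Pow {..<N}. card S = k}. g (node N (card S)))"
    by (rule sum.group[symmetric]) (auto intro: order_trans[OF card_mono[of "{..<N}"]])
  also have "\<dots> = (\<Sum>k\<le>N. real (N choose k) * g (node N k))"
  proof (rule sum.cong)
    fix k
    have "card {S\<in>Pow {..<N}. card S = k} = N choose k"
      using n_subsets[of "{..<N}" k] by simp
    then show "(\<Sum>S\<in>{S\<in>Pow {..<N}. card S = k}. g (node N (card S))) = real (N choose k) * g (node N k)"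
      by simp
  qed simp
  finally show ?thesis .
qed

subsection \<open>The energy near its maximizer\<close>

text \<open>Closed forms of the derivatives of \<open>H_fun\<close> up to order four; every index
  from 4 on yields the fourth. Truncated subtraction is harmless: where an exponent is cut off at 0,
  a preceding factor is already 0.\<close>

definition H_diff :: "real \<Rightarrow> real \<Rightarrow> nat \<Rightarrow> nat \<Rightarrow> real \<Rightarrow> real" where
  "H_diff \<beta> h p i x =
     (if i = 0 then H_fun \<beta> h p x
      else if i = 1 then \<beta> * (real p * x ^ (p - 1)) + h - (ln (1 + x) - ln (1 - x)) / 2
      else if i = 2 then \<beta> * (real p * (real (p - 1) * x ^ (p - 2))) - 1 / (1 - x\<^sup>2)
      else if i = 3 then \<beta> * (real p * (real (p - 1) * (real (p - 2) * x ^ (p - 3)))) - 2 * x / (1 - x\<^sup>2)\<^sup>2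
      else \<beta> * (real p * (real (p - 1) * (real (p - 2) * (real (p - 3) * x ^ (p - 4)))))
             - (2 + 6 * x\<^sup>2) / (1 - x\<^sup>2) ^ 3)"

lemma H_diff_0: "H_diff \<beta> h p 0 = H_fun \<beta> h p"
  by (simp add: H_diff_def fun_eq_iff)

lemma one_minus_square_pos: "x \<in> {-1<..<1} \<Longrightarrow> 1 - x\<^sup>2 > (0::real)"
  by (auto simp: abs_square_less_1 abs_less_iff)

lemma DERIV_power_pred:
  "((\<lambda>x::real. x ^ n) has_real_derivative real n * x ^ (n - 1)) (at x)"
  using DERIV_pow[of n x UNIV] by simp

lemma H_diff_has_derivative:
  assumes "i < 4" "x \<in> {-1<..<1}"
  shows "(H_diff \<beta> h p i has_real_derivative H_diff \<beta> h p (Suc i) x) (at x)"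
proof -
  have q: "1 - x\<^sup>2 > 0" using assms one_minus_square_pos by blast
  have pq: "1 + x > 0" "1 - x > 0" using assms by auto
  have P: "p - 1 - 1 = p - 2" "p - 2 - 1 = p - 3" "p - 3 - 1 = p - 4" by auto
  consider "i = 0" | "i = 1" | "i = 2" | "i = 3" using assms by linarith
  then show ?thesis
  proof cases
    case 1
    have "(H_diff \<beta> h p 0) = (\<lambda>x. \<beta> * x ^ p + h * x - ((1 + x) * ln (1 + x) + (1 - x) * ln (1 - x)) / 2)"
      by (auto simp: H_diff_def H_fun_def I_fun_def)
    then show ?thesis unfolding 1 using pq
      by (auto intro!: derivative_eq_intros DERIV_power_pred simp: H_diff_def)
  next
    case 2
    have "(H_diff \<beta> h p 1) = (\<lambda>x. \<beta> * (real p * x ^ (p - 1)) + h - (ln (1 + x) - ln (1 - x)) / 2)"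
      by (auto simp: H_diff_def)
    moreover have "1 / (1 - x\<^sup>2) = (1 / (1 + x) + 1 / (1 - x)) / 2"
      using pq q by (simp add: field_simps power2_eq_square)
    ultimately show ?thesis unfolding 2 using pq
      by (auto intro!: derivative_eq_intros DERIV_power_pred simp: H_diff_def P[symmetric])
  next
    case 3
    have "(H_diff \<beta> h p 2) = (\<lambda>x. \<beta> * (real p * (real (p - 1) * x ^ (p - 2))) - 1 / (1 - x\<^sup>2))"
      by (auto simp: H_diff_def)
    then show ?thesis unfolding 3 using q
      by (auto intro!: derivative_eq_intros DERIV_power_pred simp: H_diff_def P[symmetric] power2_eq_square)
  next
    case 4
    have "(H_diff \<beta> h p 3) = (\<lambda>x. \<beta> * (real p * (real (p - 1) * (real (p - 2) * x ^ (p - 3)))) - 2 * x / (1 - x\<^sup>2)\<^sup>2)"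
      by (auto simp: H_diff_def)
    \<comment> \<open>The right-hand side is the form in which the quotient rule delivers this
      derivative.\<close>
    moreover have "(2 + 6 * x\<^sup>2) / (1 - x\<^sup>2) ^ 3
        = (2 * (1 - x\<^sup>2)\<^sup>2 - 2 * x * (2 * (1 - x\<^sup>2) * (- (2 * x)))) / ((1 - x\<^sup>2)\<^sup>2 * (1 - x\<^sup>2)\<^sup>2)"
    proof -
      define u where "u = 1 - x\<^sup>2"
      have "2 * u\<^sup>2 - 2 * x * (2 * u * (- (2 * x))) = u * (2 + 6 * x\<^sup>2)"
        by (simp add: u_def power2_eq_square algebra_simps)
      moreover have "u \<noteq> 0" using q by (simp add: u_def)
      ultimately show ?thesis unfolding u_def[symmetric] by (simp add: power2_eq_square power3_eq_cube)
    qed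
    ultimately show ?thesis unfolding 4 using q
      by (auto intro!: derivative_eq_intros DERIV_power_pred simp: H_diff_def P[symmetric])
  qed
qed

text \<open>The closed forms are valid only on the open interval. Agreement in a neighbourhood of
  \<open>x\<close> is what lets \<open>deriv\<close> be applied to both sides.\<close>

lemma funpow_deriv_H_fun:
  assumes "i \<le> 4" "x \<in> {-1<..<1}"
  shows "(deriv ^^ i) (H_fun \<beta> h p) x = H_diff \<beta> h p i x"
  using assms
proof (induction i arbitrary: x)
  case 0
  then show ?case by (simp add: H_diff_def)
next
  case (Suc i)
  have "eventually (\<lambda>y. y \<in> {-1<..<1}) (nhds x)"
    using Suc.prems by (intro eventually_nhds_in_open) auto
  then have "eventually (\<lambda>y. (deriv ^^ i) (H_fun \<beta> h p) y = H_diff \<beta> h p i y) (nhds x)"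
    by eventually_elim (use Suc in auto)
  then have "deriv ((deriv ^^ i) (H_fun \<beta> h p)) x = deriv (H_diff \<beta> h p i) x"
    by (intro deriv_cong_ev) auto
  also have "\<dots> = H_diff \<beta> h p (Suc i) x"
    using Suc.prems by (intro DERIV_imp_deriv H_diff_has_derivative) auto
  finally show ?case by simp
qed

lemma isCont_H_diff:
  assumes "i \<le> 4" "x \<in> {-1<..<1}"
  shows "isCont (H_diff \<beta> h p i) x"
proof (cases "i = 4")
  case True
  have "H_diff \<beta> h p 4 = (\<lambda>x. \<beta> * (real p * (real (p - 1) * (real (p - 2) * (real (p - 3) * x ^ (p - 4)))))
             - (2 + 6 * x\<^sup>2) / (1 - x\<^sup>2) ^ 3)"
    by (auto simp: H_diff_def)
  then show ?thesis unfolding True using one_minus_square_pos[OF assms(2)]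
    by (auto intro!: continuous_intros)
next
  case False
  then show ?thesis using H_diff_has_derivative[of i x] assms by (intro DERIV_isCont) auto
qed

lemma H_taylor:
  assumes "m \<in> {-1<..<1}" "x \<in> {-1<..<1}" "x \<noteq> m" "0 < n" "n \<le> 4"
  shows "\<exists>t. \<bar>t - m\<bar> < \<bar>x - m\<bar> \<and> H_fun \<beta> h p x =
     (\<Sum>i<n. H_diff \<beta> h p i m / fact i * (x - m) ^ i) + H_diff \<beta> h p n t / fact n * (x - m) ^ n"
proof (cases "x > m")
  case True
  have "\<exists>t. m < t \<and> t < x \<and> H_fun \<beta> h p x =
     (\<Sum>i<n. H_diff \<beta> h p i m / fact i * (x - m) ^ i) + H_diff \<beta> h p n t / fact n * (x - m) ^ n"
    using assms True
    by (intro Taylor_up[where a = m]) (auto simp: H_diff_0 intro!: H_diff_has_derivative)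
  then show ?thesis using True by (elim ex_forward) auto
next
  case False
  have "\<exists>t. x < t \<and> t < m \<and> H_fun \<beta> h p x =
     (\<Sum>i<n. H_diff \<beta> h p i m / fact i * (x - m) ^ i) + H_diff \<beta> h p n t / fact n * (x - m) ^ n"
    using assms False
    by (intro Taylor_down[where b = m]) (auto simp: H_diff_0 intro!: H_diff_has_derivative)
  then show ?thesis using False by (elim ex_forward) auto
qed

text \<open>Only the endpoints are delicate: there u ln u tends to 0 as u decreases to 0, which
  agrees with its value at 0.\<close>

lemma continuous_on_I_fun: "continuous_on {-1..1} I_fun"
proof -
  have xlnx: "continuous_on {0..} (\<lambda>u::real. u * ln u)"
    unfolding continuous_on_def
  proof
    fix u :: real assume "u \<in> {0..}"
    show "((\<lambda>u. u * ln u) \<longlongrightarrow> u * ln u) (at u within {0..})"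
    proof (cases "u = 0")
      case True
      have "((\<lambda>u::real. u * ln u) \<longlongrightarrow> 0) (at_right 0)" by real_asymp
      moreover have "at 0 within {0..} = at_right (0::real)"
        by (simp add: at_within_Ici_at_right)
      ultimately show ?thesis using True by simp
    next
      case False
      then show ?thesis by (intro tendsto_intros) auto
    qed
  qed
  have "continuous_on {-1..1} (\<lambda>x::real. (1 + x) * ln (1 + x))"
       "continuous_on {-1..1} (\<lambda>x::real. (1 - x) * ln (1 - x))"
    by (rule continuous_on_compose2[OF xlnx]; auto intro!: continuous_intros)+
  then show ?thesis unfolding I_fun_def by (intro continuous_on_divide continuous_on_add continuous_on_const) auto
qed

lemma continuous_on_H_fun: "continuous_on {-1..1} (H_fun \<beta> h p)"
  unfolding H_fun_def by (intro continuous_intros continuous_on_I_fun)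

section \<open>The energy at a special point\<close>

context
  fixes \<beta> h m :: real and p :: nat
  assumes p: "p \<ge> 3"
    and special: "p_special \<beta> h p"
    and m: "m \<in> {-1<..<1}"
    and max: "\<forall>x\<in>{-1..1}. H_fun \<beta> h p x \<le> H_fun \<beta> h p m"
begin

text \<open>\<open>p_special\<close> speaks of a maximizer of its own. Being strict, it has to
  coincide with \<open>m\<close>.\<close>

lemma H_fun_strict_max:
  assumes "x \<in> {-1..1}" "x \<noteq> m"
  shows "H_fun \<beta> h p x < H_fun \<beta> h p m"
  using special max m assms unfolding p_special_def
  by (metis (no_types, lifting) greaterThanLessThan_iff atLeastAtMost_iff less_imp_le linorder_not_less)

lemma H_diff_1_at_max: "H_diff \<beta> h p 1 m = 0"
proof (rule DERIV_local_max)
  show "((H_fun \<beta> h p) has_real_derivative H_diff \<beta> h p 1 m) (at m)"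
    using H_diff_has_derivative[of 0 m \<beta> h p] m by (simp add: H_diff_0)
  show "0 < min (1 - m) (m + 1)" using m by auto
  show "\<forall>y. \<bar>m - y\<bar> < min (1 - m) (m + 1) \<longrightarrow> H_fun \<beta> h p y \<le> H_fun \<beta> h p m"
    using max by (auto simp: abs_less_iff intro!: max[rule_format])
qed

lemma H_diff_2_at_max: "H_diff \<beta> h p 2 m = 0"
proof -
  obtain m' where m': "m' \<in> {-1<..<1}" "\<forall>x\<in>{-1..1}. x \<noteq> m' \<longrightarrow> H_fun \<beta> h p x < H_fun \<beta> h p m'"
      "deriv (deriv (H_fun \<beta> h p)) m' = 0"
    using special unfolding p_special_def by blast
  have "m' = m" using H_fun_strict_max[of m'] m' m
    by (metis atLeastAtMost_iff greaterThanLessThan_iff less_imp_le not_less_iff_gr_or_eq)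
  then show ?thesis using m'(3) funpow_deriv_H_fun[of 2 m \<beta> h p] m by (simp add: numeral_2_eq_2)
qed

text \<open>With the first two derivatives zero, a nonzero cubic term would dominate near
  \<open>m\<close>, and a step in the direction of its sign would exceed the maximum.\<close>

lemma H_diff_3_at_max: "H_diff \<beta> h p 3 m = 0"
proof (rule ccontr)
  assume "H_diff \<beta> h p 3 m \<noteq> 0"
  define s where "s = sgn (H_diff \<beta> h p 3 m)"
  have s: "s = 1 \<or> s = -1" "s * H_diff \<beta> h p 3 m > 0"
    using \<open>H_diff \<beta> h p 3 m \<noteq> 0\<close> by (auto simp: s_def sgn_if)
  have "isCont (\<lambda>x. s * H_diff \<beta> h p 3 x) m" using isCont_H_diff[of 3 m] m by (intro continuous_intros) auto
  then have "eventually (\<lambda>x. s * H_diff \<beta> h p 3 x > 0) (nhds m)"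
    using s(2) by (metis isCont_def order_tendstoD(1) tendsto_nhds_iff)
  then obtain d where d: "d > 0" "\<And>x. \<bar>x - m\<bar> < d \<Longrightarrow> s * H_diff \<beta> h p 3 x > 0"
    unfolding eventually_nhds_metric dist_real_def by blast
  \<comment> \<open>Small enough to keep the sign of the third derivative, and at most half the
    distance to either endpoint.\<close>
  define e where "e = min d (min ((1 - m) / 2) ((1 + m) / 2))"
  have e: "e > 0" "e \<le> d" "e \<le> (1 - m) / 2" "e \<le> (1 + m) / 2"
    using d(1) m by (auto simp: e_def min_def)
  define x where "x = m + s * e"
  have x: "x \<in> {-1<..<1}" "x \<noteq> m" "\<bar>x - m\<bar> = e" using e s(1) m by (auto simp: x_def)
  obtain t where t: "\<bar>t - m\<bar> < \<bar>x - m\<bar>" "H_fun \<beta> h p x =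
     (\<Sum>i<3. H_diff \<beta> h p i m / fact i * (x - m) ^ i) + H_diff \<beta> h p 3 t / fact 3 * (x - m) ^ 3"
    using H_taylor[OF m x(1,2), of 3 \<beta> h p, OF zero_less_numeral] by fastforce
  have "H_fun \<beta> h p x = H_fun \<beta> h p m + H_diff \<beta> h p 3 t / fact 3 * (x - m) ^ 3"
    using t(2) H_diff_1_at_max H_diff_2_at_max
    by (simp add: eval_nat_numeral H_diff_0)
  \<comment> \<open>Since \<open>s\<close> is 1 or -1, its cube is \<open>s\<close> again.\<close>
  moreover have "H_diff \<beta> h p 3 t / fact 3 * (x - m) ^ 3 = s * H_diff \<beta> h p 3 t / fact 3 * e ^ 3"
    using s(1) by (auto simp: x_def)
  moreover have "s * H_diff \<beta> h p 3 t > 0" using d(2) t(1) x(3) e by simp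
  then have "s * H_diff \<beta> h p 3 t / fact 3 * e ^ 3 > 0"
    using e by (intro mult_pos_pos[OF divide_pos_pos]) auto
  ultimately have "H_fun \<beta> h p x > H_fun \<beta> h p m" by linarith
  with max[rule_format, of x] x(1) show False by auto
qed

text \<open>Combining the vanishing second and third derivatives eliminates \<open>\<beta>\<close>
  and gives \<open>real p * (1 - m\<^sup>2) = 2\<close>. The fourth derivative then depends on
  \<open>p\<close> alone.\<close>

lemma H_diff_4_at_max: "H_diff \<beta> h p 4 m = - (real p ^ 3) / 2"
proof -
  have q: "1 - m\<^sup>2 > 0" using one_minus_square_pos m by blast
  define B where "B = \<beta> * real p * real (p - 1)"
  have 2: "B * m ^ (p - 2) = 1 / (1 - m\<^sup>2)"
    using H_diff_2_at_max by (simp add: H_diff_def B_def mult_ac)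
  have 3: "B * real (p - 2) * m ^ (p - 3) = 2 * m / (1 - m\<^sup>2)\<^sup>2"
    using H_diff_3_at_max by (simp add: H_diff_def B_def mult_ac)
  have "m \<noteq> 0"
  proof
    \<comment> \<open>As \<open>p \<ge> 3\<close>, the power of \<open>m\<close> in the
      second-derivative equation would vanish, while its right-hand side is 1.\<close>
    assume "m = 0" then show False using 2 p by (simp add: power_0_left)
  qed
  have p3: "m ^ (p - 2) = m * m ^ (p - 3)"
    using p by (metis Suc_diff_le diff_Suc_Suc numeral_2_eq_2 numeral_3_eq_3 power_Suc)
  have "real (p - 2) * (1 / (1 - m\<^sup>2)) = B * real (p - 2) * m ^ (p - 3) * m"
    unfolding 2[symmetric] p3 by simp
  also have "\<dots> = 2 * m\<^sup>2 / (1 - m\<^sup>2)\<^sup>2" unfolding 3 by (simp add: power2_eq_square)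
  finally have "real (p - 2) * (1 - m\<^sup>2) = 2 * m\<^sup>2"
    using q by (simp add: power2_eq_square[of "1 - m\<^sup>2"] divide_simps)
  then have pm: "real p * (1 - m\<^sup>2) = 2" using p by (simp add: of_nat_diff algebra_simps)
  have r: "1 - m\<^sup>2 = 2 / real p" using pm p by (simp add: field_simps)
  have m2: "m\<^sup>2 = (real p - 2) / real p" using r p by (simp add: field_simps)
  \<comment> \<open>For \<open>p = 3\<close> the exponent \<open>p - 4\<close> is truncated to 0 and
    the powers differ; the factor \<open>real (p - 3)\<close> makes both sides zero.\<close>
  have p4: "real (p - 3) * m ^ (p - 3) = real (p - 3) * (m * m ^ (p - 4))"
  proof (cases "p = 3")
    case False
    then have "p - 3 = Suc (p - 4)" using p by arith
    then show ?thesis by simp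
  qed simp
  have "m\<^sup>2 * (B * (real (p - 2) * (real (p - 3) * m ^ (p - 4))))
      = real (p - 3) * m * (B * real (p - 2) * m ^ (p - 3))"
    using p4 by (auto simp: power2_eq_square)
  also have "\<dots> = m\<^sup>2 * (real (p - 3) * 2 / (1 - m\<^sup>2)\<^sup>2)" unfolding 3 by (simp add: power2_eq_square)
  finally have 4: "B * (real (p - 2) * (real (p - 3) * m ^ (p - 4))) = real (p - 3) * 2 / (1 - m\<^sup>2)\<^sup>2"
    using \<open>m \<noteq> 0\<close> by (auto simp only: mult_cancel_left power_eq_0_iff)
  have "H_diff \<beta> h p 4 m = B * (real (p - 2) * (real (p - 3) * m ^ (p - 4))) - (2 + 6 * m\<^sup>2) / (1 - m\<^sup>2) ^ 3"
    by (simp add: H_diff_def B_def mult_ac)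
  also have "\<dots> = (real p - 3) * 2 / (2 / real p)\<^sup>2 - (2 + 6 * ((real p - 2) / real p)) / (2 / real p) ^ 3"
    unfolding 4 r using m2 p by (simp add: of_nat_diff)
  also have "\<dots> = - (real p ^ 3) / 2"
    using p by (simp add: field_simps power2_eq_square power3_eq_cube)
  finally show ?thesis .
qed

text \<open>\<open>R\<close> is the quotient by the fourth power, with its singularity at
  \<open>m\<close> filled in by Taylor's formula. It is negative by strict maximality and
  \<open>c < 0\<close>, and compactness of the interval makes the bound uniform.\<close>

lemma H_fun_quartic_factorization:
  defines "c \<equiv> (deriv ^^ 4) (H_fun \<beta> h p) m"
  shows "\<exists>R \<delta>. R m = c / 24 \<and> isCont R m \<and> \<delta> > 0 \<and> (\<forall>x\<in>{-1..1}. R x \<le> - \<delta>)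
           \<and> (\<forall>x\<in>{-1..1}. H_fun \<beta> h p x - H_fun \<beta> h p m = R x * (x - m) ^ 4)"
proof -
  have c: "c = H_diff \<beta> h p 4 m" using funpow_deriv_H_fun[of 4 m] m by (simp add: c_def)
  have cneg: "c < 0" using p by (simp add: c H_diff_4_at_max)
  define R where "R x = (if x = m then c / 24 else (H_fun \<beta> h p x - H_fun \<beta> h p m) / (x - m) ^ 4)" for x
  have "(R \<longlongrightarrow> c / 24) (at m)"
  proof (rule tendstoI)
    fix e :: real assume "e > 0"
    have "isCont (\<lambda>x. H_diff \<beta> h p 4 x / 24) m" using isCont_H_diff[of 4 m] m by (intro continuous_intros) auto
    then obtain d where d: "d > 0" "\<And>x. \<bar>x - m\<bar> < d \<Longrightarrow> dist (H_diff \<beta> h p 4 x / 24) (c / 24) < e"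
      using \<open>e > 0\<close> unfolding continuous_at_eps_delta c by (metis dist_real_def)
    have "eventually (\<lambda>x. x \<in> {-1<..<1} \<inter> {m - d<..<m + d} - {m}) (at m)"
      using m d(1) by (intro eventually_at_in_open) auto
    then show "eventually (\<lambda>x. dist (R x) (c / 24) < e) (at m)"
    proof eventually_elim
      case (elim x)
      obtain t where t: "\<bar>t - m\<bar> < \<bar>x - m\<bar>" "H_fun \<beta> h p x =
          (\<Sum>i<4. H_diff \<beta> h p i m / fact i * (x - m) ^ i) + H_diff \<beta> h p 4 t / fact 4 * (x - m) ^ 4"
        using H_taylor[OF m _ _ zero_less_numeral order_refl, of x \<beta> h p] elim by blast
      have "H_fun \<beta> h p x = H_fun \<beta> h p m + H_diff \<beta> h p 4 t / 24 * (x - m) ^ 4"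
        using t(2) H_diff_1_at_max H_diff_2_at_max H_diff_3_at_max
        by (simp add: eval_nat_numeral H_diff_0 fact_numeral)
      then have "R x = H_diff \<beta> h p 4 t / 24" using elim by (simp add: R_def)
      moreover have "\<bar>t - m\<bar> < d" using t(1) elim by auto
      ultimately show ?case using d(2) by (simp only:)
    qed
  qed
  then have cont: "isCont R m" by (simp add: isCont_def R_def)
  have contR: "continuous_on {-1..1} R"
    unfolding continuous_on_eq_continuous_within
  proof
    fix x assume x: "x \<in> {-1..1::real}"
    show "continuous (at x within {-1..1}) R"
    proof (cases "x = m")
      case True then show ?thesis using cont continuous_at_imp_continuous_at_within by blast
    next
      case False
      have "continuous (at x within {-1..1}) (\<lambda>x. (H_fun \<beta> h p x - H_fun \<beta> h p m) / (x - m) ^ 4)"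
        using continuous_on_H_fun x False
        by (intro continuous_intros) (auto simp: continuous_on_eq_continuous_within)
      moreover have "eventually (\<lambda>y. y \<noteq> m) (at x within {-1..1})"
        using t1_space_nhds[OF False] by (auto simp: eventually_at_filter elim: eventually_mono)
      then have "eventually (\<lambda>y. (H_fun \<beta> h p y - H_fun \<beta> h p m) / (y - m) ^ 4 = R y) (at x within {-1..1})"
        by eventually_elim (simp add: R_def)
      ultimately show ?thesis using False
        by (auto simp: continuous_within R_def intro: Lim_transform_eventually)
    qed
  qed
  have neg: "R x < 0" if "x \<in> {-1..1}" for x
    using cneg H_fun_strict_max[of x] that by (auto simp: R_def divide_neg_pos)
  obtain z where z: "z \<in> {-1..1}" "\<forall>x\<in>{-1..1}. R x \<le> R z"
    using continuous_attains_sup[OF _ _ contR] by auto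
  show ?thesis
  proof (intro exI[of _ R] exI[of _ "- R z"] conjI)
    show "R m = c / 24" by (simp add: R_def)
    show "0 < - R z" using neg z(1) by simp
    show "\<forall>x\<in>{-1..1}. R x \<le> - (- R z)" using z by simp
    show "\<forall>x\<in>{-1..1}. H_fun \<beta> h p x - H_fun \<beta> h p m = R x * (x - m) ^ 4" by (simp add: R_def)
  qed (rule cont)
qed

end

subsection \<open>Laplace's method at a degenerate maximizer\<close>

text \<open>The magnification for which N (x - m)^4 becomes the fourth power of the rescaled
  deviation.\<close>

definition quart :: "nat \<Rightarrow> real" where
  "quart N = real N powr (1/4)"

lemma quart_pos: "N \<ge> 1 \<Longrightarrow> quart N > 0"
  by (simp add: quart_def)

lemma quart_power4: "quart N ^ 4 = real N"
  by (cases "N = 0") (simp_all add: quart_def powr_power)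

lemma quart_at_top: "filterlim quart at_top sequentially"
  unfolding quart_def by real_asymp

text \<open>Solves for the number of the cell that contains \<open>y\<close>. It is an integer
  because \<open>y\<close> may lie to the left of all cells.\<close>

definition cell_index :: "real \<Rightarrow> nat \<Rightarrow> real \<Rightarrow> int" where
  "cell_index m N y = \<lfloor>(y / quart N + m + 1) * real N / 2\<rfloor>"

text \<open>The cells \<open>[y\<^sub>k, y\<^sub>k + 2 N\<^sup>-\<^sup>3\<^sup>/\<^sup>4)\<close> with \<open>y\<^sub>k = N\<^sup>1\<^sup>/\<^sup>4 (x\<^sub>k - m)\<close> tile an interval, so that
  sums over the lattice become integrals of step functions.\<close>
definition step_fun :: "real \<Rightarrow> nat \<Rightarrow> (nat \<Rightarrow> real) \<Rightarrow> real \<Rightarrow> real" where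
  "step_fun m N v y = (\<Sum>k\<le>N. v k * indicator
     {quart N * (node N k - m)..<quart N * (node N k - m) + 2 / quart N ^ 3} y)"

text \<open>Neighbouring nodes are 2/N apart, and magnification by \<open>quart N\<close> turns this
  into the cell width 2 / N^(3/4).\<close>

lemma mem_cell_iff:
  assumes "N \<ge> 1"
  shows "y \<in> {quart N * (node N k - m)..<quart N * (node N k - m) + 2 / quart N ^ 3}
           \<longleftrightarrow> cell_index m N y = int k"
proof -
  define r where "r = quart N"
  have r: "r > 0" using quart_pos[OF assms] by (simp add: r_def)
  have N: "real N = r ^ 4" by (simp add: r_def quart_power4)
  have "y \<ge> r * (node N k - m) \<longleftrightarrow> real k \<le> (y / r + m + 1) * real N / 2"
  proof -
    have "y \<ge> r * (node N k - m) \<longleftrightarrow> node N k \<le> y / r + m"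
      using r by (simp add: field_simps)
    also have "\<dots> \<longleftrightarrow> real k \<le> (y / r + m + 1) * real N / 2"
      using assms by (simp add: node_def divide_le_eq diff_le_eq) (simp add: field_simps)
    finally show ?thesis .
  qed
  moreover have "y < r * (node N k - m) + 2 / r ^ 3 \<longleftrightarrow> (y / r + m + 1) * real N / 2 < real k + 1"
  proof -
    have "r * (node N k - m) + 2 / r ^ 3 = r * (node N k + 2 / real N - m)"
      unfolding N using r by (simp add: field_simps eval_nat_numeral)
    moreover have "y < r * (z - m) \<longleftrightarrow> y / r + m < z" for z
      using r by (simp add: field_simps)
    ultimately have "y < r * (node N k - m) + 2 / r ^ 3 \<longleftrightarrow> y / r + m < node N k + 2 / real N"
      by (simp only:)
    also have "\<dots> \<longleftrightarrow> y / r + m + 1 < (real k + 1) * 2 / real N"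
      by (simp add: node_def add_divide_distrib algebra_simps)
    also have "\<dots> \<longleftrightarrow> (y / r + m + 1) * real N / 2 < real k + 1"
      using assms by (simp add: less_divide_eq)
    finally show ?thesis .
  qed
  ultimately show ?thesis
    unfolding cell_index_def r_def[symmetric] by (auto simp: floor_eq_iff)
qed

lemma step_fun_eq:
  assumes "N \<ge> 1"
  shows "step_fun m N v y =
     (if 0 \<le> cell_index m N y \<and> cell_index m N y \<le> int N then v (nat (cell_index m N y)) else 0)"
proof -
  have "step_fun m N v y = (\<Sum>k\<le>N. if cell_index m N y = int k then v k else 0)"
    unfolding step_fun_def by (rule sum.cong) (simp_all add: indicator_def mem_cell_iff[OF assms] del: atLeastLessThan_iff)
  also have "\<dots> = (if 0 \<le> cell_index m N y \<and> cell_index m N y \<le> int N then v (nat (cell_index m N y)) else 0)"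
  proof (cases "0 \<le> cell_index m N y")
    case True
    then have "cell_index m N y = int k \<longleftrightarrow> nat (cell_index m N y) = k" for k by auto
    then show ?thesis using True by (auto simp: sum.delta' nat_le_iff)
  qed (auto intro!: sum.neutral)
  finally show ?thesis .
qed

lemma borel_measurable_step_fun [measurable]: "step_fun m N v \<in> borel_measurable borel"
  unfolding step_fun_def by measurable

lemma integral_step_fun:
  assumes "N \<ge> 1"
  shows "(LINT y|lborel. step_fun m N v y) = 2 / quart N ^ 3 * (\<Sum>k\<le>N. v k)"
proof -
  have "quart N > 0" using quart_pos assms by blast
  then show ?thesis
    unfolding step_fun_def by (subst Bochner_Integration.integral_sum) (auto simp: sum_distrib_left sum_divide_distrib mult_ac)
qed

text \<open>For fixed \<open>y\<close> the unscaled point \<open>m + y / quart N\<close> tends to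
  the interior point \<open>m\<close>, and the cell width tends to 0. This feeds the pointwise
  convergence of the step functions.\<close>

lemma cell_index_limits:
  assumes m: "m \<in> {-1<..<1}"
  defines "Y \<equiv> (\<lambda>y N. quart N * (node N (nat (cell_index m N y)) - m))"
  shows "eventually (\<lambda>N. 0 \<le> cell_index m N y \<and> cell_index m N y \<le> int N) sequentially" (is ?A)
    and "Y y \<longlonglongrightarrow> y" (is ?B)
    and "(\<lambda>N. node N (nat (cell_index m N y))) \<longlonglongrightarrow> m" (is ?C)
proof -
  have z: "(\<lambda>N. y / quart N) \<longlonglongrightarrow> 0"
    by (rule real_tendsto_divide_at_top[OF tendsto_const quart_at_top])
  then have "(\<lambda>N. y / quart N + m + 1) \<longlonglongrightarrow> 0 + m + 1" by (intro tendsto_intros)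
  note lim = order_tendstoD[OF this]
  have "eventually (\<lambda>N. y / quart N + m + 1 > 0) sequentially"
    by (rule lim(1)) (use m in auto)
  moreover have "eventually (\<lambda>N. y / quart N + m + 1 < 2) sequentially"
    by (rule lim(2)) (use m in auto)
  ultimately show A: ?A
    using eventually_ge_at_top[of 1]
  proof eventually_elim
    case (elim N)
    have "(y / quart N + m + 1) * real N / 2 \<le> 2 * real N / 2"
      using elim by (intro divide_right_mono mult_right_mono) auto
    then have "cell_index m N y \<le> int N" by (simp add: cell_index_def floor_le_iff)
    moreover have "0 \<le> cell_index m N y" using elim by (simp add: cell_index_def)
    ultimately show ?case by blast
  qed
  have mem: "eventually (\<lambda>N. y \<in> {Y y N..<Y y N + 2 / quart N ^ 3}) sequentially"
    using A eventually_ge_at_top[of 1]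
  proof eventually_elim
    case (elim N)
    then show ?case using mem_cell_iff[of N y "nat (cell_index m N y)" m] by (simp add: Y_def)
  qed
  have q0: "(\<lambda>N. 2 / quart N ^ 3) \<longlonglongrightarrow> 0"
    unfolding quart_def by real_asymp
  show B: ?B
  proof (rule tendsto_sandwich)
    show "eventually (\<lambda>N. y - 2 / quart N ^ 3 \<le> Y y N) sequentially"
      using mem by eventually_elim auto
    show "eventually (\<lambda>N. Y y N \<le> y) sequentially" using mem by eventually_elim auto
    show "(\<lambda>N. y - 2 / quart N ^ 3) \<longlonglongrightarrow> y" using tendsto_diff[OF tendsto_const q0, of y] by simp
  qed simp
  have "(\<lambda>N. m + Y y N / quart N) \<longlonglongrightarrow> m + 0"
    by (intro tendsto_intros real_tendsto_divide_at_top[OF B quart_at_top])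
  then have "(\<lambda>N. m + Y y N / quart N) \<longlonglongrightarrow> m" by simp
  then show ?C
  proof (rule Lim_transform_eventually)
    show "eventually (\<lambda>N. m + Y y N / quart N = node N (nat (cell_index m N y))) sequentially"
      using eventually_ge_at_top[of 1]
    proof eventually_elim
      case (elim N)
      then show ?case using quart_pos[of N] by (simp add: Y_def)
    qed
  qed
qed

text \<open>The quotient of the two sides is continuous and vanishes at infinity, hence is bounded.
  The shift by 2 leaves room for the distance between a point and the left end of its cell.\<close>

lemma quartic_exp_dominated:
  fixes d t :: real
  assumes "d > 0"
  shows "\<exists>C>0. \<forall>u\<ge>0. exp (- d * u ^ 4 + t * u) * (1 + u) \<le> C / (1 + (u + 2)\<^sup>2)"
proof -
  let ?g = "\<lambda>u. exp (- d * u ^ 4 + t * u) * (1 + u) * (1 + (u + 2)\<^sup>2)"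
  have "(?g \<longlongrightarrow> 0) at_top" using assms by real_asymp
  then have "eventually (\<lambda>u. ?g u < 1) at_top" by (rule order_tendstoD) simp
  then obtain B where B: "\<And>u. u \<ge> B \<Longrightarrow> ?g u < 1" by (auto simp: eventually_at_top_linorder)
  have "\<exists>z\<in>{0..max 0 B}. \<forall>u\<in>{0..max 0 B}. ?g u \<le> ?g z"
    by (intro continuous_attains_sup continuous_intros) auto
  then obtain z where z: "\<forall>u\<in>{0..max 0 B}. ?g u \<le> ?g z" by blast
  have g: "?g u \<le> max 1 (?g z)" if "u \<ge> 0" for u
  proof (cases "u \<le> B")
    case True
    then show ?thesis using z that by (intro max.coboundedI2) auto
  next
    case False
    then show ?thesis using B[of u] by (intro max.coboundedI1) auto
  qed
  have pos: "1 + (u + 2)\<^sup>2 > 0" for u :: real by (simp add: add_pos_nonneg)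
  show ?thesis
    by (rule exI[of _ "max 1 (?g z)"]) (use g in \<open>auto simp: pos_le_divide_eq[OF pos]\<close>)
qed

lemma integrable_inverse_one_plus_square:
  "integrable lborel (\<lambda>y::real. C / (1 + y\<^sup>2))"
proof -
  have "integrable lborel (\<lambda>x::real. inverse (1 + x\<^sup>2))"
    using integrable_inverse_1_plus_square by (simp add: set_integrable_def)
  then have "integrable lborel (\<lambda>x::real. C * inverse (1 + x\<^sup>2))" by (rule integrable_mult_right)
  then show ?thesis by (simp add: divide_inverse)
qed

text \<open>The weight of level \<open>k\<close> relative to exp(N H(m)), where \<open>f\<close> is
  the energy without entropy, which the binomial coefficient supplies. The term with
  \<open>t\<close> is the effect of shifting the field by t / N^(3/4).\<close>

definition lattice_weight :: "(real \<Rightarrow> real) \<Rightarrow> real \<Rightarrow> real \<Rightarrow> nat \<Rightarrow> nat \<Rightarrow> real" where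
  "lattice_weight f m t N k = real (N choose k) / 2 ^ N
     * exp (real N * (f (node N k) - (f m - I_fun m)) + t * (quart N * (node N k - m)))"

context
  fixes f R :: "real \<Rightarrow> real" and m \<delta> L :: real
  assumes m: "m \<in> {-1<..<1}" and delta: "\<delta> > 0"
    and R_cont: "isCont R m" and R_le: "\<And>x. x \<in> {-1..1} \<Longrightarrow> R x \<le> - \<delta>"
    and fR: "\<And>x. x \<in> {-1..1} \<Longrightarrow> f x - I_fun x - (f m - I_fun m) = R x * (x - m) ^ 4"
    and L: "L > 0" "stirling_ratio \<longlonglongrightarrow> L"
begin

lemma lattice_weight_eq:
  assumes "N \<ge> 1" "k \<le> N"
  defines "y \<equiv> quart N * (node N k - m)"
  shows "sqrt (real N) * lattice_weight f m t N k
           = entropy_factor N k * exp (R (node N k) * y ^ 4 + t * y)"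
proof -
  have "real N * (f (node N k) - (f m - I_fun m)) = real N * I_fun (node N k) + real N * (R (node N k) * (node N k - m) ^ 4)"
    unfolding fR[OF node_bounds[OF assms(2,1)], symmetric] by (simp add: algebra_simps)
  also have "real N * (R (node N k) * (node N k - m) ^ 4) = R (node N k) * y ^ 4"
    by (simp add: y_def power_mult_distrib quart_power4)
  finally show ?thesis
    unfolding lattice_weight_def entropy_factor_def y_def by (simp add: exp_add)
qed

text \<open>Near \<open>m\<close> both \<open>k\<close> and \<open>N - k\<close> are of order N and
  the factor is bounded. Elsewhere it is at most of order N, while the exponent is itself at least a
  multiple of N. Only half of the decay rate \<open>\<delta>\<close> is spent.\<close>

lemma entropy_factor_dominated:
  "\<exists>C>0. \<forall>N k. 1 \<le> N \<longrightarrow> k \<le> N \<longrightarrow>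
     entropy_factor N k \<le> C * exp (\<delta> / 2 * (quart N * (node N k - m)) ^ 4)"
proof -
  obtain U where U: "U > 0" "\<And>N k. 1 \<le> N \<Longrightarrow> k \<le> N \<Longrightarrow>
     entropy_factor N k \<le> U * (real N / (sqrt (max 1 (real k)) * sqrt (max 1 (real (N - k)))))"
    using entropy_factor_bound by blast
  \<comment> \<open>Half the distance from \<open>m\<close> to the nearer endpoint: nodes within
    \<open>e\<close> of \<open>m\<close> stay at least \<open>e\<close> away from both
    endpoints.\<close>
  define e where "e = (1 - \<bar>m\<bar>) / 2"
  have e: "e > 0" using m by (auto simp: e_def)
  define C where "C = 2 * U / e + 2 * U / (\<delta> * e ^ 4)"
  have C1: "C \<ge> 2 * U / e" and C2: "C \<ge> 2 * U / (\<delta> * e ^ 4)" and C0: "C > 0"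
    using U(1) e delta by (auto simp: C_def intro!: add_pos_pos divide_pos_pos mult_pos_pos)
  show ?thesis
  proof (intro exI[of _ C] conjI allI impI)
    show "C > 0" by (rule C0)
    fix N k :: nat assume N: "1 \<le> N" and k: "k \<le> N"
    let ?x = "node N k"
    let ?d = "sqrt (max 1 (real k)) * sqrt (max 1 (real (N - k)))"
    let ?v = "\<delta> / 2 * (quart N * (?x - m)) ^ 4"
    have v0: "?v \<ge> 0" using delta by simp
    show "entropy_factor N k \<le> C * exp ?v"
    proof (cases "\<bar>?x - m\<bar> \<le> e")
      case True
      then have "\<bar>?x\<bar> \<le> 1 - e" using abs_triangle_ineq[of m "?x - m"] by (simp add: e_def field_simps)
      then have x: "1 + ?x \<ge> e" "1 - ?x \<ge> e" by auto
      have "real k = (1 + ?x) * real N / 2" "real (N - k) = (1 - ?x) * real N / 2"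
        using N k by (auto simp: node_def field_simps of_nat_diff)
      then have "real k \<ge> e * real N / 2" "real (N - k) \<ge> e * real N / 2"
        using x by (auto intro!: divide_right_mono mult_right_mono)
      then have "sqrt (e * real N / 2) * sqrt (e * real N / 2) \<le> ?d"
        using e by (intro mult_mono real_sqrt_le_mono) auto
      then have "e * real N / 2 \<le> ?d" using e by simp
      then have "real N / ?d \<le> real N / (e * real N / 2)"
        using e N by (intro divide_left_mono) auto
      then have "U * (real N / ?d) \<le> U * (real N / (e * real N / 2))"
        using U(1) by (intro mult_left_mono) auto
      also have "\<dots> = 2 * U / e" using e N by (simp add: field_simps)
      also have "\<dots> \<le> C * 1" using C1 by simp
      also have "\<dots> \<le> C * exp ?v" using C0 v0 by (intro mult_left_mono) auto
      finally show ?thesis using U(2)[OF N k] by linarith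
    next
      case False
      have "1 * 1 \<le> ?d" by (intro mult_mono) auto
      then have "real N / ?d \<le> real N / 1" by (intro divide_left_mono) auto
      then have "U * (real N / ?d) \<le> U * real N" using U(1) by (intro mult_left_mono) auto
      also have "\<dots> = 2 * U / (\<delta> * e ^ 4) * (\<delta> / 2 * e ^ 4 * real N)"
        using e delta by (simp add: field_simps)
      also have "\<dots> \<le> C * exp ?v"
      proof (intro mult_mono C2)
        have "e ^ 4 \<le> \<bar>?x - m\<bar> ^ 4" using False e by (intro power_mono) auto
        then have "e ^ 4 \<le> (?x - m) ^ 4" by simp
        then have "\<delta> / 2 * (e ^ 4 * real N) \<le> \<delta> / 2 * ((?x - m) ^ 4 * real N)"
          using delta by (intro mult_left_mono mult_right_mono) auto
        also have "\<dots> = ?v" by (simp add: power_mult_distrib quart_power4)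
        also have "\<dots> \<le> exp ?v" using exp_ge_add_one_self[of ?v] by linarith
        finally show "\<delta> / 2 * e ^ 4 * real N \<le> exp ?v" by (simp add: mult.assoc)
      qed (use delta C0 e in auto)
      finally show ?thesis using U(2)[OF N k] by linarith
    qed
  qed
qed

text \<open>The other half of \<open>\<delta>\<close> yields an integrable majorant. The factor in
  front admits test functions of linear growth, as the mean requires.\<close>

lemma lattice_weight_dominated:
  "\<exists>C>0. \<forall>N k. 1 \<le> N \<longrightarrow> k \<le> N \<longrightarrow>
     (1 + \<bar>quart N * (node N k - m)\<bar>) * (sqrt (real N) * lattice_weight f m t N k)
       \<le> C / (1 + (\<bar>quart N * (node N k - m)\<bar> + 2)\<^sup>2)"
proof -
  obtain A where A: "A > 0" "\<And>N k. 1 \<le> N \<Longrightarrow> k \<le> N \<Longrightarrow>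
     entropy_factor N k \<le> A * exp (\<delta> / 2 * (quart N * (node N k - m)) ^ 4)"
    using entropy_factor_dominated by blast
  obtain B where B: "B > 0" "\<And>u. u \<ge> 0 \<Longrightarrow>
     exp (- (\<delta> / 2) * u ^ 4 + \<bar>t\<bar> * u) * (1 + u) \<le> B / (1 + (u + 2)\<^sup>2)"
    using quartic_exp_dominated[of "\<delta> / 2" "\<bar>t\<bar>"] delta by auto
  show ?thesis
  proof (intro exI[of _ "A * B"] conjI allI impI)
    show "A * B > 0" using A B by simp
    fix N k :: nat assume N: "1 \<le> N" and k: "k \<le> N"
    define y where "y = quart N * (node N k - m)"
    have "R (node N k) * y ^ 4 + t * y \<le> - \<delta> * y ^ 4 + \<bar>t\<bar> * \<bar>y\<bar>"
      using R_le[OF node_bounds[OF k N]] abs_ge_self[of "t * y"]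
      by (intro add_mono mult_right_mono) (auto simp: abs_mult)
    then have "entropy_factor N k * exp (R (node N k) * y ^ 4 + t * y)
        \<le> (A * exp (\<delta> / 2 * y ^ 4)) * exp (- \<delta> * y ^ 4 + \<bar>t\<bar> * \<bar>y\<bar>)"
      using A(2)[OF N k] A(1) by (intro mult_mono) (auto simp: y_def)
    also have "\<dots> = A * exp (- (\<delta> / 2) * \<bar>y\<bar> ^ 4 + \<bar>t\<bar> * \<bar>y\<bar>)"
      by (simp add: mult_exp_exp mult.assoc)
    finally have "(1 + \<bar>y\<bar>) * (sqrt (real N) * lattice_weight f m t N k)
        \<le> (1 + \<bar>y\<bar>) * (A * exp (- (\<delta> / 2) * \<bar>y\<bar> ^ 4 + \<bar>t\<bar> * \<bar>y\<bar>))"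
      unfolding lattice_weight_eq[OF N k] y_def by (intro mult_left_mono) auto
    also have "\<dots> = A * (exp (- (\<delta> / 2) * \<bar>y\<bar> ^ 4 + \<bar>t\<bar> * \<bar>y\<bar>) * (1 + \<bar>y\<bar>))"
      by (simp only: mult_ac)
    also have "\<dots> \<le> A * (B / (1 + (\<bar>y\<bar> + 2)\<^sup>2))" using A(1) by (intro mult_left_mono B(2)) auto
    finally show "(1 + \<bar>quart N * (node N k - m)\<bar>) * (sqrt (real N) * lattice_weight f m t N k)
       \<le> A * B / (1 + (\<bar>quart N * (node N k - m)\<bar> + 2)\<^sup>2)" by (simp add: y_def)
  qed
qed

text \<open>Dominated convergence for the step functions. Test functions may vary with
  \<open>N\<close> and need a limit only at almost every \<open>y\<close>, along every sequence
  tending to \<open>y\<close>; this admits the indicator of an event whose threshold moves with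
  \<open>N\<close>.\<close>

lemma laplace_lattice_sum:
  fixes \<phi> :: "nat \<Rightarrow> real \<Rightarrow> real" and \<psi> :: "real \<Rightarrow> real"
  assumes bound: "\<And>N x. \<bar>\<phi> N x\<bar> \<le> 1 + \<bar>quart N * (x - m)\<bar>"
    and [measurable]: "\<psi> \<in> borel_measurable borel"
    and lim: "AE y in lborel. \<forall>Y. Y \<longlonglongrightarrow> y \<longrightarrow> (\<lambda>N. \<phi> N (m + Y N / quart N)) \<longlonglongrightarrow> \<psi> y"
  shows "integrable lborel (\<lambda>y. \<psi> y * exp (R m * y ^ 4 + t * y))"
    and "(\<lambda>N. 2 / quart N ^ 3 * (\<Sum>k\<le>N. \<phi> N (node N k) * (sqrt (real N) * lattice_weight f m t N k)))
           \<longlonglongrightarrow> 2 / (L * sqrt (1 - m\<^sup>2)) * (LINT y|lborel. \<psi> y * exp (R m * y ^ 4 + t * y))"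
proof -
  let ?K = "2 / (L * sqrt (1 - m\<^sup>2))"
  have K: "?K > 0"
  proof -
    have "m\<^sup>2 < 1" using m by (auto simp: abs_square_less_1 abs_less_iff)
    then show ?thesis using L(1) by simp
  qed
  define v where "v N k = \<phi> N (node N k) * (sqrt (real N) * lattice_weight f m t N k)" for N k
  obtain C where C: "C > 0" "\<And>N k. 1 \<le> N \<Longrightarrow> k \<le> N \<Longrightarrow>
     (1 + \<bar>quart N * (node N k - m)\<bar>) * (sqrt (real N) * lattice_weight f m t N k)
       \<le> C / (1 + (\<bar>quart N * (node N k - m)\<bar> + 2)\<^sup>2)"
    using lattice_weight_dominated by blast
  have w0: "lattice_weight f m t N k \<ge> 0" for N k by (simp add: lattice_weight_def)
  have dom: "\<bar>step_fun m N (v N) y\<bar> \<le> C / (1 + y\<^sup>2)" if N: "N \<ge> 1" for N y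
  proof (cases "0 \<le> cell_index m N y \<and> cell_index m N y \<le> int N")
    case True
    define k where "k = nat (cell_index m N y)"
    have k: "k \<le> N" "cell_index m N y = int k" using True by (auto simp: k_def)
    define z where "z = quart N * (node N k - m)"
    have "y \<in> {z..<z + 2 / quart N ^ 3}" unfolding z_def using mem_cell_iff[OF N] k by blast
    moreover have "2 / quart N ^ 3 \<le> 2 / 1"
    proof -
      have "quart N \<ge> 1" unfolding quart_def using N by (intro ge_one_powr_ge_zero) auto
      then show ?thesis by (intro divide_left_mono) auto
    qed
    ultimately have "\<bar>y\<bar> \<le> \<bar>z\<bar> + 2" by auto
    then have y2: "y\<^sup>2 \<le> (\<bar>z\<bar> + 2)\<^sup>2" using abs_le_square_iff[of y "\<bar>z\<bar> + 2"] by simp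
    have "\<bar>step_fun m N (v N) y\<bar> = \<bar>v N k\<bar>" using True by (simp add: step_fun_eq[OF N] k_def)
    also have "\<dots> = \<bar>\<phi> N (node N k)\<bar> * (sqrt (real N) * lattice_weight f m t N k)"
      using w0 by (simp add: v_def abs_mult)
    also have "\<dots> \<le> (1 + \<bar>z\<bar>) * (sqrt (real N) * lattice_weight f m t N k)"
      using bound[of N "node N k"] w0 by (intro mult_right_mono) (auto simp: z_def)
    also have "\<dots> \<le> C / (1 + (\<bar>z\<bar> + 2)\<^sup>2)" using C(2)[OF N k(1)] by (simp add: z_def)
    also have "\<dots> \<le> C / (1 + y\<^sup>2)"
      using y2 C(1) by (intro divide_left_mono mult_pos_pos add_pos_nonneg) auto
    finally show ?thesis .
  next
    case False
    then show ?thesis using C(1) by (auto simp: step_fun_eq[OF N])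
  qed
  have conv: "AE y in lborel. (\<lambda>N. step_fun m (Suc N) (v (Suc N)) y) \<longlonglongrightarrow> ?K * (\<psi> y * exp (R m * y ^ 4 + t * y))"
    using lim
  proof eventually_elim
    case (elim y)
    define k where "k N = nat (cell_index m N y)" for N
    \<comment> \<open>The left end of the cell containing \<open>y\<close>; the node there is
      \<open>m + Y N / quart N\<close>, the form required by the hypothesis on test
      functions.\<close>
    define Y where "Y N = quart N * (node N (k N) - m)" for N
    note cl = cell_index_limits[OF m, of y, folded k_def, folded Y_def]
    have kN: "eventually (\<lambda>N. k N \<le> N) sequentially"
      using cl(1) by eventually_elim (auto simp: k_def)
    have R: "(\<lambda>N. R (node N (k N))) \<longlonglongrightarrow> R m"
      using isCont_tendsto_compose[OF R_cont cl(3)] .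
    have "(\<lambda>N. \<phi> N (m + Y N / quart N) * (entropy_factor N (k N) * exp (R (node N (k N)) * Y N ^ 4 + t * Y N)))
        \<longlonglongrightarrow> \<psi> y * (?K * exp (R m * y ^ 4 + t * y))"
      using elim cl(2) R
      by (intro tendsto_intros entropy_factor_tendsto[OF L(2,1) cl(3) m kN]) auto
    then have "(\<lambda>N. step_fun m N (v N) y) \<longlonglongrightarrow> \<psi> y * (?K * exp (R m * y ^ 4 + t * y))"
    proof (rule Lim_transform_eventually)
      show "eventually (\<lambda>N. \<phi> N (m + Y N / quart N) * (entropy_factor N (k N) * exp (R (node N (k N)) * Y N ^ 4 + t * Y N))
            = step_fun m N (v N) y) sequentially"
        using cl(1) kN eventually_ge_at_top[of 1]
      proof eventually_elim
        case (elim N)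
        have "m + Y N / quart N = node N (k N)" using quart_pos[OF elim(3)] by (simp add: Y_def)
        then show ?case
          using elim by (simp add: step_fun_eq v_def lattice_weight_eq flip: k_def Y_def)
      qed
    qed
    from LIMSEQ_Suc[OF this] show ?case by (simp add: mult.left_commute)
  qed
  have lim_meas: "(\<lambda>y. ?K * (\<psi> y * exp (R m * y ^ 4 + t * y))) \<in> borel_measurable lborel"
    by measurable
  have bnd: "AE y in lborel. norm (step_fun m (Suc N) (v (Suc N)) y) \<le> C / (1 + y\<^sup>2)" for N
    using dom by auto
  have step_meas: "step_fun m (Suc N) (v (Suc N)) \<in> borel_measurable lborel" for N by simp
  note dct = lim_meas step_meas integrable_inverse_one_plus_square conv bnd
  have "integrable lborel (\<lambda>y. ?K * (\<psi> y * exp (R m * y ^ 4 + t * y)))"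
    by (rule integrable_dominated_convergence[OF dct])
  then have "integrable lborel (\<lambda>y. inverse ?K * (?K * (\<psi> y * exp (R m * y ^ 4 + t * y))))"
    by (rule integrable_mult_right)
  moreover have "inverse a * (a * b) = b" if "a > 0" for a b :: real
    using that by simp
  ultimately show "integrable lborel (\<lambda>y. \<psi> y * exp (R m * y ^ 4 + t * y))"
    using K by (simp only:)
  have "(\<lambda>N. LINT y|lborel. step_fun m (Suc N) (v (Suc N)) y) \<longlonglongrightarrow>
          (LINT y|lborel. ?K * (\<psi> y * exp (R m * y ^ 4 + t * y)))"
    by (rule integral_dominated_convergence[OF dct])
  then have "(\<lambda>N. 2 / quart (Suc N) ^ 3 * (\<Sum>k\<le>Suc N. v (Suc N) k)) \<longlonglongrightarrow>
          ?K * (LINT y|lborel. \<psi> y * exp (R m * y ^ 4 + t * y))"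
    by (simp add: integral_step_fun del: sum.atMost_Suc)
  then show "(\<lambda>N. 2 / quart N ^ 3 * (\<Sum>k\<le>N. \<phi> N (node N k) * (sqrt (real N) * lattice_weight f m t N k)))
           \<longlonglongrightarrow> ?K * (LINT y|lborel. \<psi> y * exp (R m * y ^ 4 + t * y))"
    unfolding v_def by (rule filterlim_sequentially_Suc[THEN iffD1])
qed

end

subsection \<open>The maximum likelihood estimator\<close>

text \<open>Each map t -> v exp(t v) with \<open>v\<close> nonzero is strictly increasing, whatever
  the sign of \<open>v\<close>.\<close>

lemma exp_weighted_sum_strict_mono:
  fixes a u :: "'a \<Rightarrow> real"
  assumes "finite A" "\<And>i. i \<in> A \<Longrightarrow> a i > 0" "i \<in> A" "u i \<noteq> 0" "s < t"
  shows "(\<Sum>i\<in>A. a i * (u i * exp (s * u i))) < (\<Sum>i\<in>A. a i * (u i * exp (t * u i)))"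
proof (rule sum_strict_mono_ex1)
  have *: "v * exp (s * v) < v * exp (t * v)" if "v \<noteq> 0" for v :: real
    using that assms(5) by (cases "v > 0") (auto simp: mult_less_cancel_left)
  then have **: "v * exp (s * v) \<le> v * exp (t * v)" for v :: real
    by (cases "v = 0") (auto intro: less_imp_le)
  show "\<forall>i\<in>A. a i * (u i * exp (s * u i)) \<le> a i * (u i * exp (t * u i))"
    using assms(2) ** by (auto intro!: mult_left_mono less_imp_le)
  show "\<exists>i\<in>A. a i * (u i * exp (s * u i)) < a i * (u i * exp (t * u i))"
    using assms(2-4) by (intro bexI[of _ i] mult_strict_left_mono *) auto
qed (use assms in auto)

lemma exp_weighted_sum_ex_nonneg:
  fixes a u :: "'a \<Rightarrow> real"
  assumes "finite A" "\<And>i. i \<in> A \<Longrightarrow> a i > 0" "j \<in> A" "u j > 0"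
  shows "\<exists>t\<ge>0. (\<Sum>i\<in>A. a i * (u i * exp (t * u i))) \<ge> 0"
proof -
  define S where "S = (\<Sum>i\<in>A. a i * u i)"
  \<comment> \<open>Chosen so that the gain \<open>a j * (t * (u j)\<^sup>2)\<close> from the
    tangent bound at \<open>j\<close> is exactly the absolute value of \<open>S\<close>; the other
    terms do not decrease.\<close>
  define t where "t = \<bar>S\<bar> / (a j * (u j)\<^sup>2)"
  have aj: "a j > 0" using assms by auto
  have t0: "t \<ge> 0" using aj by (auto simp: t_def)
  have 1: "v * exp (t * v) \<ge> v" for v
  proof (cases "v \<ge> 0")
    case True
    then show ?thesis using t0 mult_left_mono[of 1 "exp (t * v)" v] by simp
  next
    case False
    then have "t * v \<le> 0" using t0 by (auto simp: mult_nonneg_nonpos)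
    then show ?thesis using False mult_left_mono_neg[of "exp (t * v)" 1 v] by simp
  qed
  have 2: "u j * exp (t * u j) \<ge> u j + t * (u j)\<^sup>2"
  proof -
    have "u j * (1 + t * u j) \<le> u j * exp (t * u j)"
      using assms(4) by (intro mult_left_mono exp_ge_add_one_self) auto
    then show ?thesis by (simp add: power2_eq_square algebra_simps)
  qed
  have "0 \<le> S + \<bar>S\<bar>" by simp
  also have "\<bar>S\<bar> = a j * (t * (u j)\<^sup>2)" using aj assms(4) by (simp add: t_def)
  also have "S + a j * (t * (u j)\<^sup>2) = (\<Sum>i\<in>A. a i * (u i + (if i = j then t * (u j)\<^sup>2 else 0)))"
    using assms by (simp add: S_def distrib_left sum.distrib if_distrib[of "\<lambda>x. _ * x"] sum.delta cong: if_cong)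
  also have "\<dots> \<le> (\<Sum>i\<in>A. a i * (u i * exp (t * u i)))"
    using assms(2) 1 2 by (intro sum_mono mult_left_mono) (auto intro: less_imp_le)
  finally show ?thesis using t0 by blast
qed

text \<open>The preceding bound for \<open>u\<close> and for \<open>- u\<close> gives both signs,
  and the intermediate value theorem gives the root.\<close>

lemma exp_weighted_sum_zero:
  fixes a u :: "'a \<Rightarrow> real"
  assumes "finite A" "\<And>i. i \<in> A \<Longrightarrow> a i > 0" "j \<in> A" "u j > 0" "k \<in> A" "u k < 0"
  shows "\<exists>t. (\<Sum>i\<in>A. a i * (u i * exp (t * u i))) = 0"
proof -
  let ?f = "\<lambda>t. \<Sum>i\<in>A. a i * (u i * exp (t * u i))"
  obtain t where t: "t \<ge> 0" "?f t \<ge> 0"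
    using exp_weighted_sum_ex_nonneg[of A a j u] assms by auto
  obtain s where s: "s \<ge> 0" "(\<Sum>i\<in>A. a i * (- u i * exp (s * - u i))) \<ge> 0"
    using exp_weighted_sum_ex_nonneg[of A a k "\<lambda>i. - u i"] assms by auto
  have "?f (- s) \<le> 0" using s(2) by (simp add: sum_negf)
  moreover have "continuous_on {-s..t} ?f" by (intro continuous_intros)
  ultimately show ?thesis using IVT'[of ?f "-s" 0 t] t s(1) by auto
qed

section \<open>The mean magnetization as a function of the field\<close>

lemma cw_weight_pos: "cw_weight \<beta> h p N x > 0"
  by (simp add: cw_weight_def)

lemma configs_nonempty: "configs N \<noteq> {}"
  by (auto simp: configs_def PiE_eq_empty_iff)

lemma cw_Z_pos: "cw_Z \<beta> h p N > 0"
  unfolding cw_Z_def by (intro sum_pos finite_configs configs_nonempty cw_weight_pos)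

text \<open>Up to a positive factor, the mean minus \<open>y\<close> is an exponentially weighted
  sum with parameter \<open>h\<close>, so its sign and its root can be read off there.\<close>

lemma cw_mean_diff:
  "(cw_mean \<beta> h p N - y) * (cw_Z \<beta> h p N * exp (- (h * (real N * y)))) =
     (\<Sum>x\<in>configs N. cw_weight \<beta> 0 p N x * ((xbar N x - y) * exp (h * (real N * (xbar N x - y)))))"
proof -
  have "(cw_mean \<beta> h p N - y) * cw_Z \<beta> h p N = (\<Sum>x\<in>configs N. (xbar N x - y) * cw_weight \<beta> h p N x)"
    using cw_Z_pos[of \<beta> h p N]
    by (simp add: cw_mean_def cw_Z_def field_simps sum_subtractf sum_distrib_left)
  moreover have "cw_weight \<beta> h p N x * exp (- (h * (real N * y)))
      = cw_weight \<beta> 0 p N x * exp (h * (real N * (xbar N x - y)))" for x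
    by (simp add: cw_weight_def mult_exp_exp algebra_simps)
  ultimately show ?thesis
    by (simp add: mult.assoc[symmetric] sum_distrib_right) (simp add: mult.assoc mult.left_commute)
qed

text \<open>For \<open>y\<close> strictly inside the interval the constant configurations supply
  deviations of both signs, so the likelihood equation has exactly one root and \<open>THE\<close>
  selects it. At 1 or -1 there is no root.\<close>

lemma mle_h_le_iff:
  assumes "N \<ge> 1" "y \<in> {-1<..<1}"
  shows "mle_h \<beta> p N y \<le> h \<longleftrightarrow> y \<le> cw_mean \<beta> h p N"
proof -
  \<comment> \<open>A factor \<open>real N\<close> is moved from the weight to the deviation, so
    that the exponent is \<open>t * u x\<close>.\<close>
  define a where "a x = cw_weight \<beta> 0 p N x / real N" for x
  define u where "u x = real N * (xbar N x - y)" for x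
  define f where "f t = (\<Sum>x\<in>configs N. a x * (u x * exp (t * u x)))" for t
  have apos: "a x > 0" for x using assms cw_weight_pos by (simp add: a_def)
  have f: "f h = (cw_mean \<beta> h p N - y) * (cw_Z \<beta> h p N * exp (- (h * (real N * y))))" for h
    unfolding cw_mean_diff using assms by (simp add: f_def a_def u_def)
  have E: "cw_Z \<beta> h p N * exp (- (h * (real N * y))) > 0" for h using cw_Z_pos by simp
  define x1 x2 :: "nat \<Rightarrow> real" where "x1 = (\<lambda>i. if i < N then 1 else undefined)"
    and "x2 = (\<lambda>i. if i < N then -1 else undefined)"
  have x1: "x1 \<in> configs N" "xbar N x1 = 1" and x2: "x2 \<in> configs N" "xbar N x2 = -1"
    using assms by (auto simp: x1_def x2_def configs_def xbar_def PiE_def extensional_def)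
  have u1: "u x1 > 0" and u2: "u x2 < 0"
    using x1 x2 assms by (auto simp: u_def zero_less_mult_iff mult_less_0_iff)
  obtain t where t: "f t = 0"
    using exp_weighted_sum_zero[of "configs N" a x1 u x2] apos x1 x2 u1 u2 by (auto simp: f_def)
  have mono: "f s < f t" if "s < t" for s t
    unfolding f_def using exp_weighted_sum_strict_mono[of "configs N" a x1 u s t] apos x1 u1 that by auto
  have zero: "cw_mean \<beta> s p N = y \<longleftrightarrow> s = t" for s
    using f[of s] E[of s] t mono[of s t] mono[of t s] by (cases s t rule: linorder_cases) auto
  then have "mle_h \<beta> p N y = t" by (simp add: mle_h_def)
  moreover have "t \<le> h \<longleftrightarrow> 0 \<le> f h"
    using t mono[of t h] mono[of h t] by (cases h t rule: linorder_cases) auto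
  moreover have "0 \<le> f h \<longleftrightarrow> y \<le> cw_mean \<beta> h p N"
    unfolding f using E[of h] by (smt (verit) zero_le_mult_iff)
  ultimately show ?thesis by simp
qed

subsection \<open>The limit distribution\<close>

text \<open>The prefactor does not depend on \<open>g\<close>, hence cancels in expectations and
  probabilities.\<close>

lemma cw_sum_eq:
  assumes N: "N \<ge> 1"
  shows "(\<Sum>x\<in>configs N. g (xbar N x) * cw_weight \<beta> (h + t / quart N ^ 3) p N x)
     = exp (real N * H_fun \<beta> h p m + t * quart N * m)
       * (\<Sum>k\<le>N. g (node N k) * lattice_weight (\<lambda>x. \<beta> * x ^ p + h * x) m t N k)"
proof -
  have r: "quart N > 0" using quart_pos[OF N] .
  have tN: "real N * (t / quart N ^ 3) = t * quart N"
    using r by (simp add: quart_power4[of N, symmetric] field_simps eval_nat_numeral)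
  have e: "real N * (\<beta> * x ^ p + (h + t / quart N ^ 3) * x)
      = (real N * H_fun \<beta> h p m + t * quart N * m)
        + (real N * ((\<beta> * x ^ p + h * x) - ((\<beta> * m ^ p + h * m) - I_fun m)) + t * (quart N * (x - m)))" for x
  proof -
    have "real N * (\<beta> * x ^ p + (h + t / quart N ^ 3) * x)
        = real N * (\<beta> * x ^ p + h * x) + real N * (t / quart N ^ 3) * x"
      by (simp only: algebra_simps)
    then show ?thesis unfolding tN by (simp add: H_fun_def algebra_simps)
  qed
  define G where "G x = g x * (exp (real N * (\<beta> * x ^ p + (h + t / quart N ^ 3) * x)) / 2 ^ N)" for x
  have "(\<Sum>x\<in>configs N. g (xbar N x) * cw_weight \<beta> (h + t / quart N ^ 3) p N x)
      = (\<Sum>x\<in>configs N. G (xbar N x))"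
    by (simp add: G_def cw_weight_def)
  also have "\<dots> = (\<Sum>k\<le>N. real (N choose k) * G (node N k))" by (rule sum_configs[OF N])
  also have "\<dots> = exp (real N * H_fun \<beta> h p m + t * quart N * m)
       * (\<Sum>k\<le>N. g (node N k) * lattice_weight (\<lambda>x. \<beta> * x ^ p + h * x) m t N k)"
    unfolding sum_distrib_left G_def e lattice_weight_def exp_add by (intro sum.cong) auto
  finally show ?thesis .
qed

lemma F_dens_0: "F_dens c p m 0 t y = exp (c / 24 * y ^ 4 + t * y)"
  by (simp add: F_dens_def)

theorem mainTheorem4:
  fixes p :: nat and \<beta> h m :: real
  assumes "p \<ge> 3" and "\<beta> \<ge> 0"
    and "p_special \<beta> h p"
    and "m \<in> {-1<..<1}" and "\<forall>x\<in>{-1..1}. H_fun \<beta> h p x \<le> H_fun \<beta> h p m"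
  defines "c \<equiv> (deriv ^^ 4) (H_fun \<beta> h p) m"
  defines "G1 \<equiv> (\<lambda>t. F_cdf c p m 0 0 (F_mean c p m 0 t))"
  shows "\<forall>t. isCont G1 t \<longrightarrow>
     (\<lambda>N. cw_prob \<beta> h p N
        {x. real N powr (3/4) * (mle_h \<beta> p N (xbar N x) - h) \<le> t}) \<longlonglongrightarrow> G1 t"
proof (intro allI impI)
  fix t :: real
  note m = assms(4)
  obtain R \<delta> where Rm: "R m = c / 24" and R: "isCont R m" "\<delta> > 0" "\<And>x. x \<in> {-1..1} \<Longrightarrow> R x \<le> - \<delta>"
      "\<And>x. x \<in> {-1..1} \<Longrightarrow> H_fun \<beta> h p x - H_fun \<beta> h p m = R x * (x - m) ^ 4"
    using H_fun_quartic_factorization[OF assms(1,3-5)] unfolding c_def by blast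
  obtain L where L: "L > 0" "stirling_ratio \<longlonglongrightarrow> L" using stirling_ratio_tendsto by blast
  define f where "f x = \<beta> * x ^ p + h * x" for x
  have fR: "f x - I_fun x - (f m - I_fun m) = R x * (x - m) ^ 4" if "x \<in> {-1..1}" for x
    using R(4)[OF that] by (simp add: f_def H_fun_def)
  define S where "S t \<phi> N = 2 / quart N ^ 3 *
      (\<Sum>k\<le>N. \<phi> N (node N k) * (sqrt (real N) * lattice_weight f m t N k))"
    for t and \<phi> :: "nat \<Rightarrow> real \<Rightarrow> real" and N
  define K where "K = 2 / (L * sqrt (1 - m\<^sup>2))"
  have K: "K > 0"
    using one_minus_square_pos[OF m] L(1) by (simp add: K_def)
  define J where "J t \<psi> = (LINT y|lborel. \<psi> y * F_dens c p m 0 t y)" for t \<psi>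
  note laplace = laplace_lattice_sum[OF m R(2,1,3) fR L,
      folded S_def K_def, unfolded Rm, folded F_dens_0[of c p m], folded J_def]
  have S_eq: "(\<Sum>x\<in>configs N. \<phi> N (xbar N x) * cw_weight \<beta> (h + t / quart N ^ 3) p N x)
      = exp (real N * H_fun \<beta> h p m + t * quart N * m) / (2 / quart N ^ 3 * sqrt (real N)) * S t \<phi> N"
    if "N \<ge> 1" for N t \<phi>
  proof -
    have "S t \<phi> N = (2 / quart N ^ 3 * sqrt (real N)) * (\<Sum>k\<le>N. \<phi> N (node N k) * lattice_weight f m t N k)"
      by (simp add: S_def sum_distrib_left mult_ac)
    then show ?thesis
      using that quart_pos[OF that] by (simp add: cw_sum_eq[OF that, of "\<phi> N"] f_def[abs_def])
  qed

  have one: "(\<lambda>N. S t (\<lambda>_ _. 1) N) \<longlonglongrightarrow> K * J t (\<lambda>_. 1)"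
    and int1: "integrable lborel (\<lambda>y. 1 * F_dens c p m 0 t y)" for t
    by (rule laplace; auto)+
  have J_pos: "J t (\<lambda>_. 1) > 0" for t
  proof -
    have "J t (\<lambda>_. 1) \<ge> 0" unfolding J_def by (intro integral_nonneg_AE) (auto simp: F_dens_0)
    moreover have "J t (\<lambda>_. 1) \<noteq> 0"
    proof
      assume "J t (\<lambda>_. 1) = 0"
      \<comment> \<open>A zero integral would force the everywhere positive density to vanish almost
        everywhere.\<close>
      then have "AE y in lborel. 1 * F_dens c p m 0 t y = 0"
        unfolding J_def by (subst (asm) integral_nonneg_eq_0_iff_AE[OF int1]) (auto simp: F_dens_0)
      then show False
        by (simp add: F_dens_0 eventually_False ae_filter_eq_bot_iff)
    qed
    ultimately show ?thesis by simp
  qed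

  \<comment> \<open>The rescaled mean under the shifted field: the threshold for the rescaled
    magnetization in the event under study.\<close>
  define s where "s N = quart N * (cw_mean \<beta> (h + t / quart N ^ 3) p N - m)" for N
  have s_lim: "s \<longlonglongrightarrow> F_mean c p m 0 t"
  proof -
    have "(\<lambda>N. S t (\<lambda>N x. quart N * (x - m)) N) \<longlonglongrightarrow> K * J t (\<lambda>y. y)"
    proof (rule laplace)
      show "AE y in lborel. \<forall>Y. Y \<longlonglongrightarrow> y \<longrightarrow> (\<lambda>N. quart N * (m + Y N / quart N - m)) \<longlonglongrightarrow> y"
      proof (intro AE_I2 allI impI)
        fix y and Y :: "nat \<Rightarrow> real" assume "Y \<longlonglongrightarrow> y"
        then show "(\<lambda>N. quart N * (m + Y N / quart N - m)) \<longlonglongrightarrow> y"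
        proof (rule Lim_transform_eventually)
          show "eventually (\<lambda>N. Y N = quart N * (m + Y N / quart N - m)) sequentially"
            using eventually_ge_at_top[of 1]
            by eventually_elim (use quart_pos in force)
        qed
      qed
    qed auto
    from tendsto_divide[OF this one[of t]]
    have "(\<lambda>N. S t (\<lambda>N x. quart N * (x - m)) N / S t (\<lambda>_ _. 1) N) \<longlonglongrightarrow> J t (\<lambda>y. y) / J t (\<lambda>_. 1)"
      using K J_pos[of t] by simp
    also have "J t (\<lambda>y. y) / J t (\<lambda>_. 1) = F_mean c p m 0 t" by (simp add: J_def F_mean_def)
    finally show ?thesis
    proof (rule Lim_transform_eventually)
      show "eventually (\<lambda>N. S t (\<lambda>N x. quart N * (x - m)) N / S t (\<lambda>_ _. 1) N = s N) sequentially"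
        using eventually_ge_at_top[of 1]
      proof eventually_elim
        case (elim N)
        let ?w = "cw_weight \<beta> (h + t / quart N ^ 3) p N"
        let ?Z = "cw_Z \<beta> (h + t / quart N ^ 3) p N"
        have "s N = (\<Sum>x\<in>configs N. quart N * (xbar N x - m) * ?w x) / (\<Sum>x\<in>configs N. 1 * ?w x)"
        proof -
          have "(\<Sum>x\<in>configs N. quart N * (xbar N x - m) * ?w x)
              = quart N * ((\<Sum>x\<in>configs N. xbar N x * ?w x) - m * ?Z)"
            by (simp add: cw_Z_def sum_distrib_left sum_subtractf algebra_simps)
          moreover have "(\<Sum>x\<in>configs N. 1 * ?w x) = ?Z" by (simp add: cw_Z_def)
          ultimately show ?thesis
            using cw_Z_pos[of \<beta> "h + t / quart N ^ 3" p N]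
            by (simp add: s_def cw_mean_def field_simps)
        qed
        also have "\<dots> = S t (\<lambda>N x. quart N * (x - m)) N / S t (\<lambda>_ _. 1) N"
          using elim quart_pos[OF elim]
          by (simp only: S_eq[OF elim, of "\<lambda>N x. quart N * (x - m)"] S_eq[OF elim, of "\<lambda>_ _. 1"]) simp
        finally show ?case by simp
      qed
    qed
  qed

  define E where "E N x \<longleftrightarrow> real N powr (3/4) * (mle_h \<beta> p N x - h) \<le> t" for N x
  define \<phi> :: "nat \<Rightarrow> real \<Rightarrow> real" where "\<phi> N x = of_bool (E N x)" for N x
  let ?s = "F_mean c p m 0 t"
  have E_iff: "E N x \<longleftrightarrow> quart N * (x - m) \<le> s N" if "N \<ge> 1" "x \<in> {-1<..<1}" for N x
  proof -
    have r: "quart N > 0" using quart_pos that by blast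
    have "real N powr (3/4) = quart N ^ 3" using that by (simp add: quart_def powr_power)
    then have "E N x \<longleftrightarrow> mle_h \<beta> p N x \<le> h + t / quart N ^ 3"
      using r by (simp add: E_def field_simps)
    also have "\<dots> \<longleftrightarrow> x \<le> cw_mean \<beta> (h + t / quart N ^ 3) p N" by (rule mle_h_le_iff[OF that])
    also have "\<dots> \<longleftrightarrow> quart N * (x - m) \<le> s N" using r by (simp add: s_def)
    finally show ?thesis .
  qed
  have "(\<lambda>N. S 0 \<phi> N) \<longlonglongrightarrow> K * J 0 (indicator {..?s})"
  proof (rule laplace)
    \<comment> \<open>The limiting indicator jumps only at \<open>?s\<close>, a null set. At every
      other \<open>y\<close> the limit of \<open>s N - Y N\<close> is nonzero, so its sign is
      eventually fixed.\<close>
    have "AE y in lborel. y \<noteq> ?s" by (rule AE_lborel_singleton)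
    then show "AE y in lborel. \<forall>Y. Y \<longlonglongrightarrow> y \<longrightarrow> (\<lambda>N. \<phi> N (m + Y N / quart N)) \<longlonglongrightarrow> indicator {..?s} y"
    proof eventually_elim
      case (elim y)
      show ?case
      proof (intro allI impI)
        fix Y assume Y: "Y \<longlonglongrightarrow> y"
        have "(\<lambda>N. m + Y N / quart N) \<longlonglongrightarrow> m + 0"
          by (intro tendsto_intros real_tendsto_divide_at_top[OF Y quart_at_top])
        \<comment> \<open>This keeps the magnetization away from 1 and -1, where the estimator has
          no defining equation.\<close>
        then have "eventually (\<lambda>N. m + Y N / quart N \<in> {-1<..<1}) sequentially"
          using m by (intro topological_tendstoD) auto
        moreover have "eventually (\<lambda>N. (Y N \<le> s N) = (y \<le> ?s)) sequentially"
        proof (cases "y < ?s")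
          case True
          have "eventually (\<lambda>N. s N - Y N > 0) sequentially"
            by (rule order_tendstoD[OF tendsto_diff[OF s_lim Y]]) (use True in simp)
          then show ?thesis by eventually_elim (use True in auto)
        next
          case False
          have "eventually (\<lambda>N. s N - Y N < 0) sequentially"
            by (rule order_tendstoD[OF tendsto_diff[OF s_lim Y]]) (use False elim in simp)
          then show ?thesis by eventually_elim (use False elim in auto)
        qed
        ultimately have "eventually (\<lambda>N. indicator {..?s} y = \<phi> N (m + Y N / quart N)) sequentially"
          using eventually_ge_at_top[of 1]
        proof eventually_elim
          case (elim N)
          have "quart N * (m + Y N / quart N - m) = Y N" using quart_pos[OF elim(3)] by simp
          then have "E N (m + Y N / quart N) \<longleftrightarrow> y \<le> ?s"
            using E_iff[OF elim(3,1)] elim(2) by simp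
          then show ?case by (simp add: \<phi>_def indicator_def)
        qed
        then show "(\<lambda>N. \<phi> N (m + Y N / quart N)) \<longlonglongrightarrow> indicator {..?s} y"
          by (rule Lim_transform_eventually[OF tendsto_const])
      qed
    qed
  qed (auto simp: \<phi>_def)
  from tendsto_divide[OF this one[of 0]]
  have "(\<lambda>N. S 0 \<phi> N / S 0 (\<lambda>_ _. 1) N) \<longlonglongrightarrow> J 0 (indicator {..?s}) / J 0 (\<lambda>_. 1)"
    using K J_pos[of 0] by simp
  also have "J 0 (indicator {..?s}) / J 0 (\<lambda>_. 1) = G1 t"
    by (simp add: J_def G1_def F_cdf_def set_lebesgue_integral_def)
  finally show "(\<lambda>N. cw_prob \<beta> h p N
        {x. real N powr (3/4) * (mle_h \<beta> p N (xbar N x) - h) \<le> t}) \<longlonglongrightarrow> G1 t"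
  proof (rule Lim_transform_eventually)
    show "eventually (\<lambda>N. S 0 \<phi> N / S 0 (\<lambda>_ _. 1) N = cw_prob \<beta> h p N
        {x. real N powr (3/4) * (mle_h \<beta> p N (xbar N x) - h) \<le> t}) sequentially"
      using eventually_ge_at_top[of 1]
    proof eventually_elim
      case (elim N)
      \<comment> \<open>The unshifted field is written with the shift
        \<open>0 / quart N ^ 3\<close>, so that \<open>S_eq\<close> applies with parameter
        0.\<close>
      have "cw_prob \<beta> h p N {x. real N powr (3/4) * (mle_h \<beta> p N (xbar N x) - h) \<le> t}
          = (\<Sum>x\<in>configs N. \<phi> N (xbar N x) * cw_weight \<beta> (h + 0 / quart N ^ 3) p N x)
            / (\<Sum>x\<in>configs N. 1 * cw_weight \<beta> (h + 0 / quart N ^ 3) p N x)"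
        unfolding cw_prob_def cw_Z_def
        by (simp add: \<phi>_def E_def sum.inter_filter Int_def of_bool_def if_distrib[of "\<lambda>x. x * _"] cong: if_cong)
      also have "\<dots> = S 0 \<phi> N / S 0 (\<lambda>_ _. 1) N"
        using elim quart_pos[OF elim]
        by (simp only: S_eq[OF elim, of \<phi>] S_eq[OF elim, of "\<lambda>_ _. 1"]) simp
      finally show ?case by simp
    qed
  qed
qed

end
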